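(* Fix an integer $n\ge 4$ and a vector $b\in\mathbb{R}^n$. There exist a nonempty open set $\mathcal{A}_n\subset\mathbb{S}_{++}^n$ consisting of matrices with simple spectrum and, for every $A\in\mathcal{A}_n$, a nonempty open set $\mathcal{X}_n(A)\subset\mathbb{R}^n\setminus\{x_*\}$ (where $x_*=A^{-1}b$) with the following properties. (1) For every $A\in\mathcal{A}_n$ and every $x_0\in\mathcal{X}_n(A)$, the BB1 iteration for $f_{A,b}$ started at $x_0$ is well-defined for every $k\ge 0$, converges to $x_*$, and satisfies, for every $i\in\{1,\dots,n\}$ and every $k\ge0$, $$(10^{-6})^k\,\|\Pi_i(A)g_0\|\le\|\Pi_i(A)g_k\|\le(0.61)^k\,\|\Pi_i(A)g_0\| .$$ In particular, none of the initial spectral components $\Pi_i(A)g_0$ is zero. (2) The set $\Omega_n:=\{(A,x):A\in\mathcal{A}_n,\ x\in\mathcal{X}_n(A)\}\subset\mathbb{S}_{++}^n\times\mathbb{R}^n$ is nonempty and open. Consequently $\Omega_n$ has positive Lebesgue measure in $\mathbb{S}^n\times\mathbb{R}^n$, and each fiber $\mathcal{X}_n(A)$, $A\in\mathcal{A}_n$, has positive Lebesgue measure in $\mathbb{R}^n$. (3) For every $A\in\mathcal{A}_n$ and $x_0\in\mathcal{X}_n(A)$, writing $f=f_{A,b}$, $e_k=x_k-x_*$ and $\|e\|_A=(e^TAe)^{1/2}$, one has for all $k\ge0$ $$(10^{-6})^k\|g_0\|\le\|g_k\|\le(0.61)^k\|g_0\|,$$ $$(10^{-6})^k\|e_0\|_A\le\|e_k\|_A\le(0.61)^k\|e_0\|_A,$$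 $$(10^{-6})^{2k}\bigl(f(x_0)-f(x_* )\bigr)\le f(x_k)-f(x_* )\le(0.61)^{2k}\bigl(f(x_0)-f(x_* )\bigr).$$ Thus $$\liminf_{k\to\infty}\|g_k\|^{1/k}\ge10^{-6},\qquad \liminf_{k\to\infty}\|e_k\|_A^{1/k}\ge10^{-6},$$ and these BB1 orbits are not root-superlinearly or $Q$-superlinearly convergent.
   Context: $\mathbb{S}^n$ is the Euclidean space (of dimension $n(n+1)/2$) of real symmetric $n\times n$ matrices and $\mathbb{S}_{++}^n$ its open cone of positive-definite matrices. $\|\cdot\|$ is the Euclidean norm. For $A\in\mathbb{S}_{++}^n$ and $b\in\mathbb{R}^n$, let $f_{A,b}(x)=\tfrac12x^TAx-b^Tx$, with unique minimizer $x_*=A^{-1}b$ and gradient $g(x)=Ax-b$. BB1 iteration (long Barzilai–Borwein method) started at $x_0\ne x_*$: write $g_k:=Ax_k-b$. Put $$\alpha_0:=\frac{g_0^Tg_0}{g_0^TAg_0},\qquad x_1:=x_0-\alpha_0g_0,$$ and for $k\ge1$, provided the quantities are defined (nonzero denominator), $$s_{k-1}:=x_k-x_{k-1},\quad y_{k-1}:=g_k-g_{k-1},\quad \alpha_k:=\frac{s_{k-1}^Ts_{k-1}}{s_{k-1}^Ty_{k-1}},\quad x_{k+1}:=x_k-\alpha_kg_k .$$ For $A$ with simple spectrum, $0<\lambda_1(A)<\cdots<\lambda_n(A)$ are its ordered eigenvalues and $\Pi_i(A)$ is the orthogonal projector onto the one-dimensional eigenspace of $\lambda_i(A)$. For a positive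 sequence $u_k\to0$ (here $u_k=\|g_k\|$ or $u_k=\|e_k\|_A$), root-superlinear convergence means $u_k^{1/k}\to0$, and $Q$-superlinear convergence means $u_{k+1}/u_k\to0$. *)

theory Defs
  imports "HOL-Analysis.Analysis"
begin

text \<open>
  The Euclidean space of real symmetric matrices, with the inner product, norm and topology
  inherited from \<^typ>\<open>real^'n^'n\<close> (so the norm is the Frobenius norm).  Making it an instance of
  \<^class>\<open>euclidean_space\<close> provides Lebesgue measure on it and on its product with \<^typ>\<open>real^'n\<close>.
\<close>

typedef 'n::finite sym_matrix = "{A :: real^'n^'n. transpose A = A}"
  morphisms mat_of Sym_matrix
  by (rule exI[of _ "mat 1"]) (simp add: transpose_mat)

setup_lifting type_definition_sym_matrix

lemma transpose_mat_of [simp]: "transpose (mat_of A) = mat_of A"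
  using mat_of[of A] by simp

lemma mat_of_commute: "mat_of A $ i $ j = mat_of A $ j $ i"
proof -
  have "transpose (mat_of A) $ i $ j = mat_of A $ j $ i" by (simp add: transpose_def del: transpose_mat_of)
  then show ?thesis by simp
qed

instantiation sym_matrix :: (finite) real_inner
begin

lift_definition zero_sym_matrix :: "'a sym_matrix" is 0
  by (simp add: transpose_def vec_eq_iff)

lift_definition plus_sym_matrix :: "'a sym_matrix \<Rightarrow> 'a sym_matrix \<Rightarrow> 'a sym_matrix" is "(+)"
  by (simp add: transpose_def vec_eq_iff)

lift_definition minus_sym_matrix :: "'a sym_matrix \<Rightarrow> 'a sym_matrix \<Rightarrow> 'a sym_matrix" is "(-)"
  by (simp add: transpose_def vec_eq_iff)

lift_definition uminus_sym_matrix :: "'a sym_matrix \<Rightarrow> 'a sym_matrix" is uminus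
  by (simp add: transpose_def vec_eq_iff)

lift_definition scaleR_sym_matrix :: "real \<Rightarrow> 'a sym_matrix \<Rightarrow> 'a sym_matrix" is "(*\<^sub>R)"
  by (simp add: transpose_def vec_eq_iff)

lift_definition inner_sym_matrix :: "'a sym_matrix \<Rightarrow> 'a sym_matrix \<Rightarrow> real" is "(\<bullet>)" .

lift_definition norm_sym_matrix :: "'a sym_matrix \<Rightarrow> real" is norm .

definition dist_sym_matrix :: "'a sym_matrix \<Rightarrow> 'a sym_matrix \<Rightarrow> real"
  where "dist_sym_matrix A B = norm (A - B)"

definition sgn_sym_matrix :: "'a sym_matrix \<Rightarrow> 'a sym_matrix"
  where "sgn_sym_matrix A = scaleR (inverse (norm A)) A"

definition uniformity_sym_matrix :: "('a sym_matrix \<times> 'a sym_matrix) filter"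
  where "uniformity_sym_matrix = (INF e\<in>{0<..}. principal {(A, B). dist A B < e})"

definition open_sym_matrix :: "'a sym_matrix set \<Rightarrow> bool"
  where "open_sym_matrix S = (\<forall>A\<in>S. \<forall>\<^sub>F (A', B) in uniformity. A' = A \<longrightarrow> B \<in> S)"

instance
proof
  fix A B C :: "'a sym_matrix" and r s :: real
  show "A + B + C = A + (B + C)" "A + B = B + A" "0 + A = A" "- A + A = 0" "A - B = A + - B"
    "r *\<^sub>R (A + B) = r *\<^sub>R A + r *\<^sub>R B" "(r + s) *\<^sub>R A = r *\<^sub>R A + s *\<^sub>R A"
    "r *\<^sub>R s *\<^sub>R A = (r * s) *\<^sub>R A" "1 *\<^sub>R A = A"
    by (transfer; simp add: algebra_simps)+
  show "dist A B = norm (A - B)" "sgn A = scaleR (inverse (norm A)) A"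
    by (simp_all add: dist_sym_matrix_def sgn_sym_matrix_def)
  show "(uniformity :: ('a sym_matrix \<times> 'a sym_matrix) filter)
      = (INF e\<in>{0<..}. principal {(A, B). dist A B < e})"
    by (rule uniformity_sym_matrix_def)
  show "open U = (\<forall>A\<in>U. \<forall>\<^sub>F (A', B) in uniformity. A' = A \<longrightarrow> B \<in> U)"
    for U :: "'a sym_matrix set"
    by (rule open_sym_matrix_def)
  show "A \<bullet> B = B \<bullet> A"
    by transfer (rule inner_commute)
  show "(A + B) \<bullet> C = A \<bullet> C + B \<bullet> C"
    by transfer (rule inner_add_left)
  show "(r *\<^sub>R A) \<bullet> B = r * (A \<bullet> B)"
    by transfer (rule inner_scaleR_left)
  show "0 \<le> A \<bullet> A"
    by transfer (rule inner_ge_zero)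
  show "(A \<bullet> A = 0) = (A = 0)"
    by transfer (rule inner_eq_zero_iff)
  show "norm A = sqrt (A \<bullet> A)"
    by transfer (rule norm_eq_sqrt_inner)
qed

end

text \<open>
  The orthonormal basis is indexed by unordered pairs: the diagonal matrix units, and the matrices
  with both off-diagonal entries equal to \<open>1 / sqrt 2\<close>.
\<close>

lift_definition sym_basis :: "'n::finite \<Rightarrow> 'n \<Rightarrow> 'n sym_matrix"
  is "\<lambda>i j. \<chi> k l. if {k, l} = {i, j} then (if i = j then 1 else 1 / sqrt 2) else 0"
  by (simp add: transpose_def vec_eq_iff insert_commute)

lemma sym_basis_eqI:
  assumes "{i, j} = {k, l}"
  shows "sym_basis i j = sym_basis k l"
proof -
  have "i = j \<longleftrightarrow> k = l" using assms by (auto simp: doubleton_eq_iff)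
  then show ?thesis using assms by (simp add: mat_of_inject[symmetric] sym_basis.rep_eq)
qed

lemma inner_sym_basis:
  fixes A :: "'n::finite sym_matrix"
  shows "A \<bullet> sym_basis i j = (if i = j then 1 else sqrt 2) * mat_of A $ i $ j"
proof -
  let ?c = "if i = j then 1 else 1 / sqrt 2"
  have "A \<bullet> sym_basis i j
      = (\<Sum>k\<in>UNIV. \<Sum>l\<in>UNIV. mat_of A $ k $ l * (if {k, l} = {i, j} then ?c else 0))"
    by (simp add: inner_sym_matrix.rep_eq sym_basis.rep_eq inner_vec_def)
  also have "\<dots> = (\<Sum>p\<in>UNIV. mat_of A $ fst p $ snd p * (if {fst p, snd p} = {i, j} then ?c else 0))"
    by (simp add: sum.cartesian_product split_beta)
  also have "\<dots> = (\<Sum>p\<in>{(i, j), (j, i)}. mat_of A $ fst p $ snd p * ?c)"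
    by (rule sum.mono_neutral_cong_right) (auto simp: doubleton_eq_iff)
  also have "\<dots> = (if i = j then 1 else sqrt 2) * mat_of A $ i $ j"
  proof (cases "i = j")
    case False
    then have "(\<Sum>p\<in>{(i, j), (j, i)}. mat_of A $ fst p $ snd p * ?c) = 2 / sqrt 2 * mat_of A $ i $ j"
      using mat_of_commute[of A j i] by simp
    then show ?thesis using False by (simp add: real_div_sqrt)
  qed simp
  finally show ?thesis .
qed

instantiation sym_matrix :: (finite) euclidean_space
begin

definition Basis_sym_matrix :: "'a sym_matrix set"
  where "Basis_sym_matrix = {sym_basis i j | i j. True}"

instance
proof
  show "(Basis :: 'a sym_matrix set) \<noteq> {}"
    by (auto simp: Basis_sym_matrix_def)
  have "(\<lambda>p. sym_basis (fst p) (snd p)) ` UNIV = (Basis :: 'a sym_matrix set)"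
    by (auto simp: Basis_sym_matrix_def image_def)
  moreover have "finite ((\<lambda>p :: 'a \<times> 'a. sym_basis (fst p) (snd p)) ` UNIV)"
    by (rule finite_imageI) (rule finite)
  ultimately show "finite (Basis :: 'a sym_matrix set)"
    by (rule subst)
next
  fix U V :: "'a sym_matrix" assume "U \<in> Basis" "V \<in> Basis"
  then obtain i j k l where U: "U = sym_basis i j" and V: "V = sym_basis k l"
    by (auto simp: Basis_sym_matrix_def)
  have *: "U \<bullet> V = (if {k, l} = {i, j} then 1 else 0)"
  proof (cases "{k, l} = {i, j}")
    case True
    then have "i = j \<longleftrightarrow> k = l" by (auto simp: doubleton_eq_iff)
    then show ?thesis using True by (simp add: U V inner_sym_basis sym_basis.rep_eq)
  next
    case False
    then show ?thesis by (simp add: U V inner_sym_basis sym_basis.rep_eq)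
  qed
  show "U \<bullet> V = (if U = V then 1 else 0)"
  proof (cases "{k, l} = {i, j}")
    case True
    then have "U = V" unfolding U V by (rule sym_basis_eqI[symmetric])
    then show ?thesis using * True by simp
  next
    case False
    have "V \<bullet> V = 1"
      unfolding V inner_sym_basis by (simp add: sym_basis.rep_eq)
    then have "U \<noteq> V" using * False by auto
    then show ?thesis using * False by simp
  qed
next
  fix A :: "'a sym_matrix"
  show "(\<forall>U\<in>Basis. A \<bullet> U = 0) \<longleftrightarrow> A = 0"
  proof
    assume "\<forall>U\<in>Basis. A \<bullet> U = 0"
    then have *: "A \<bullet> sym_basis i j = 0" for i j
      unfolding Basis_sym_matrix_def by blast
    have "mat_of A $ i $ j = 0" for i j
      using *[of i j] by (simp add: inner_sym_basis split: if_splits)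
    then have "mat_of A = mat_of 0" by (simp add: vec_eq_iff zero_sym_matrix.rep_eq)
    then show "A = 0" by (simp add: mat_of_inject)
  next
    assume "A = 0"
    then show "\<forall>U\<in>Basis. A \<bullet> U = 0" by simp
  qed
qed

end

lemma DIM_sym_matrix: "DIM('n::finite sym_matrix) = CARD('n) * (CARD('n) + 1) div 2"
proof -
  define supp where "supp U = {k. \<exists>l. mat_of U $ k $ l \<noteq> 0}" for U :: "'n sym_matrix"
  have supp: "supp (sym_basis i j) = {i, j}" for i j
  proof -
    have "mat_of (sym_basis i j) $ k $ l \<noteq> 0 \<longleftrightarrow> {k, l} = {i, j}" for k l
      by (simp add: sym_basis.rep_eq)
    then have "supp (sym_basis i j) = {k. \<exists>l. {k, l} = {i, j}}"
      by (simp add: supp_def)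
    also have "\<dots> = {i, j}" by (auto simp: doubleton_eq_iff)
    finally show ?thesis .
  qed
  have eq: "sym_basis i j = sym_basis k l" if "{i, j} = {k, l}" for i j k l :: 'n
    using that by (rule sym_basis_eqI)
  have "inj_on supp Basis"
    by (rule inj_onI) (auto simp: Basis_sym_matrix_def supp intro: eq)
  then have "DIM('n sym_matrix) = card (supp ` Basis)"
    by (simp add: card_image)
  also have "supp ` Basis = {S. S \<subseteq> UNIV \<and> card S = 1} \<union> {S. S \<subseteq> UNIV \<and> card S = 2}"
  proof -
    have "supp ` Basis = {{i, j} | i j. True}"
      unfolding Basis_sym_matrix_def using supp by (auto simp: image_def) metis
    also have "\<dots> = {S. S \<subseteq> UNIV \<and> card S = 1} \<union> {S. S \<subseteq> UNIV \<and> card S = 2}"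
      by (auto simp: card_1_singleton_iff card_2_iff card_insert_if)
    finally show ?thesis .
  qed
  also have "card \<dots> = (CARD('n) choose 1) + (CARD('n) choose 2)"
    by (subst card_Un_disjoint) (simp_all only: n_subsets[OF finite] finite, auto)
  also have "\<dots> = CARD('n) * (CARD('n) + 1) div 2"
    by (cases "CARD('n)") (auto simp: choose_two algebra_simps)
  finally show ?thesis .
qed

definition pos_def :: "real^'n^'n \<Rightarrow> bool"
  where "pos_def A \<longleftrightarrow> transpose A = A \<and> (\<forall>x. x \<noteq> 0 \<longrightarrow> x \<bullet> (A *v x) > 0)"

definition eigenspace :: "real^'n^'n \<Rightarrow> real \<Rightarrow> (real^'n) set"
  where "eigenspace A c = {v. A *v v = c *\<^sub>R v}"

definition spectrum :: "real^'n^'n \<Rightarrow> real set"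
  where "spectrum A = {c. \<exists>v. v \<noteq> 0 \<and> A *v v = c *\<^sub>R v}"

text \<open>
  Simplicity means that there are \<open>n\<close> distinct eigenvalues; for symmetric matrices this is the same
  as all eigenspaces being one-dimensional.
\<close>

definition simple_spectrum :: "real^'n^'n \<Rightarrow> bool"
  where "simple_spectrum A \<longleftrightarrow> card (spectrum A) = CARD('n)"

text \<open>
  The \<open>i\<close>-th smallest eigenvalue, counted from \<open>i = 1\<close>; meaningful for \<open>i \<in> {1..CARD('n)}\<close> when
  the spectrum is simple.
\<close>

definition eigval :: "nat \<Rightarrow> real^'n^'n \<Rightarrow> real"
  where "eigval i A = sorted_list_of_set (spectrum A) ! (i - 1)"

definition orth_proj :: "'a::euclidean_space set \<Rightarrow> 'a \<Rightarrow> 'a"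
  where "orth_proj S x = (THE p. p \<in> S \<and> (\<forall>v\<in>S. orthogonal (x - p) v))"

lemma orth_proj_eqI:
  assumes "subspace S" "p \<in> S" "\<And>v. v \<in> S \<Longrightarrow> orthogonal (x - p) v"
  shows "orth_proj S x = p"
  unfolding orth_proj_def
proof (rule the_equality)
  fix q assume q: "q \<in> S \<and> (\<forall>v\<in>S. orthogonal (x - q) v)"
  have "p - q \<in> S" using assms q by (simp add: subspace_diff)
  then have "(x - q) \<bullet> (p - q) = 0" "(x - p) \<bullet> (p - q) = 0"
    using assms q by (auto simp: orthogonal_def)
  then have "(p - q) \<bullet> (p - q) = 0" by (simp add: inner_diff_left)
  then show "q = p" by simp
qed (use assms in auto)

lemma subspace_eigenspace: "subspace (eigenspace A c)"
  by (auto simp: subspace_def eigenspace_def matrix_vector_right_distrib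
      matrix_vector_mult_scaleR algebra_simps)

definition spectral_proj :: "nat \<Rightarrow> real^'n^'n \<Rightarrow> real^'n \<Rightarrow> real^'n"
  where "spectral_proj i A = orth_proj (eigenspace A (eigval i A))"

definition quad_fun :: "real^'n^'n \<Rightarrow> real^'n \<Rightarrow> real^'n \<Rightarrow> real"
  where "quad_fun A b x = 1/2 * (x \<bullet> (A *v x)) - b \<bullet> x"

definition minimizer :: "real^'n^'n \<Rightarrow> real^'n \<Rightarrow> real^'n"
  where "minimizer A b = matrix_inv A *v b"

definition grad :: "real^'n^'n \<Rightarrow> real^'n \<Rightarrow> real^'n \<Rightarrow> real^'n"
  where "grad A b x = A *v x - b"

definition energy_norm :: "real^'n^'n \<Rightarrow> real^'n \<Rightarrow> real"
  where "energy_norm A e = sqrt (e \<bullet> (A *v e))"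

text \<open>
  As division by zero yields zero, the iteration is a total function; that no denominator
  vanishes is stated separately by \<open>bb1_well_defined\<close>.
\<close>

fun bb1 :: "real^'n^'n \<Rightarrow> real^'n \<Rightarrow> real^'n \<Rightarrow> nat \<Rightarrow> real^'n"
  where
    "bb1 A b x0 0 = x0"
  | "bb1 A b x0 (Suc 0) =
      (let g0 = grad A b x0 in x0 - ((g0 \<bullet> g0) / (g0 \<bullet> (A *v g0))) *\<^sub>R g0)"
  | "bb1 A b x0 (Suc (Suc k)) =
      (let x = bb1 A b x0 (Suc k); s = x - bb1 A b x0 k;
           y = grad A b x - grad A b (bb1 A b x0 k)
       in x - ((s \<bullet> s) / (s \<bullet> y)) *\<^sub>R grad A b x)"

definition bb1_well_defined :: "real^'n^'n \<Rightarrow> real^'n \<Rightarrow> real^'n \<Rightarrow> bool"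
  where "bb1_well_defined A b x0 \<longleftrightarrow>
    grad A b x0 \<bullet> (A *v grad A b x0) \<noteq> 0 \<and>
    (\<forall>k. (bb1 A b x0 (Suc k) - bb1 A b x0 k) \<bullet>
         (grad A b (bb1 A b x0 (Suc k)) - grad A b (bb1 A b x0 k)) \<noteq> 0)"

text \<open>
  Both notions are meant for positive sequences converging to zero.  These requirements are not
  part of the definitions, so that the negations really exclude the respective limits.
\<close>

definition root_superlinear :: "(nat \<Rightarrow> real) \<Rightarrow> bool"
  where "root_superlinear u \<longleftrightarrow> (\<lambda>k. u k powr (1 / real k)) \<longlonglongrightarrow> 0"

definition Q_superlinear :: "(nat \<Rightarrow> real) \<Rightarrow> bool"
  where "Q_superlinear u \<longleftrightarrow> (\<lambda>k. u (Suc k) / u k) \<longlonglongrightarrow> 0"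

end

theory Submission
  imports Defs
begin

text \<open>
  Let \<open>c\<^sub>i\<close> be the coefficients of the gradient with respect to eigenvectors of \<open>A\<close> with eigenvalues \<open>\<lambda>\<^sub>i\<close>.
  One step multiplies \<open>c\<^sub>i\<close> by \<open>1 - \<lambda>\<^sub>i / \<rho>\<close>, where \<open>\<rho>\<close> is the Rayleigh quotient of the
  previous gradient (in the first step, of the current one).  If the spectrum lies in an interval such as \<open>[1.7, 2.7]\<close>, then so does \<open>\<rho>\<close>, and all factors
  are below \<open>0.61\<close> in absolute value; this settles the upper bounds.  The lower bounds follow if
  \<open>\<rho>\<close> never comes close to an eigenvalue, and for this the orbit has to be controlled for all times.

  Up to a common factor the weights \<open>c\<^sub>i\<^sup>2\<close> are multiplied by \<open>(\<lambda>\<^sub>i - \<rho>)\<^sup>2\<close>, and \<open>\<rho>\<close> is their mean of the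
  \<open>\<lambda>\<^sub>i\<close> one step before.  With \<open>d\<^sub>i = \<lambda>\<^sub>i - \<lambda>\<^sub>0\<close>, \<open>m = \<rho> - \<lambda>\<^sub>0\<close> and weights relative to that of the smallest
  eigenvalue \<open>\<lambda>\<^sub>0\<close> this is a rational recursion which does not depend on \<open>\<lambda>\<^sub>0\<close>.  For four suitable eigenvalues it has
  an attracting cycle of period seven, along which \<open>m\<close> keeps its distance from all \<open>d\<^sub>i\<close>.  The cycle
  need not be known exactly: it suffices to have a small parallelepiped around an approximate
  point of it which seven steps map into itself
  (\<open>trap_returns\<close>) and an initial point that enters it (\<open>start_enters_trap\<close>).  Both are checked by
  affine arithmetic with integer coefficients, with a tolerance for the eigenvalues and the initial
  weights, and hence on an open set of data.  The consequence is \<open>separated_forever\<close>.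

  Further eigenvalues are placed just above \<open>\<lambda>\<^sub>0\<close>.  As \<open>m\<close> stays above them, their weights never grow
  relative to that of \<open>\<lambda>\<^sub>0\<close>, and if they are tiny initially, they remain within the
  tolerance (\<open>weights_separated\<close>).

  Finally, symmetric matrices near a diagonal matrix with distinct entries have an orthonormal
  eigenbasis near the standard one (\<open>near_diagonal_eigenbasis\<close>), so the tolerances translate into a
  ball of matrices and a ball of initial points (\<open>bb1_orbits_nearby\<close>).
\<close>

section \<open>Affine arithmetic with integer coefficients\<close>

text \<open>
  A form \<open>(c, as, e)\<close> describes the reals within distance \<open>e\<close> of \<open>c + \<Sum> as\<^sub>i \<xi>\<^sub>i\<close>, where the noise
  vector \<open>\<xi>\<close> ranges over a cube.  Unlike plain intervals, forms that share \<open>\<xi>\<close> remember how the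
  quantities depend on each other.  This is indispensable here: single steps of the recursion
  stretch some directions a lot, and only their composition over a period contracts.
  Lists are padded with zeros, so that a form without noise is just \<open>(c, [], e)\<close>.
\<close>

type_synonym form = "int \<times> int list \<times> int"

fun dot :: "int list \<Rightarrow> real list \<Rightarrow> real"
  where
    "dot (a # as) (x # xs) = of_int a * x + dot as xs"
  | "dot _ _ = 0"

fun padded_add :: "int list \<Rightarrow> int list \<Rightarrow> int list"
  where
    "padded_add (a # as) (b # bs) = (a + b) # padded_add as bs"
  | "padded_add [] bs = bs"
  | "padded_add as [] = as"

fun abs_sum :: "int list \<Rightarrow> int"
  where
    "abs_sum [] = 0"
  | "abs_sum (a # as) = \<bar>a\<bar> + abs_sum as"

fun int_length :: "int list \<Rightarrow> int"
  where
    "int_length [] = 0"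
  | "int_length (a # as) = 1 + int_length as"

definition noise :: "real list \<Rightarrow> bool"
  where "noise \<xi> \<longleftrightarrow> (\<forall>x\<in>set \<xi>. \<bar>x\<bar> \<le> 1)"

definition enc :: "real list \<Rightarrow> form \<Rightarrow> real \<Rightarrow> bool"
  where "enc \<xi> f X = (case f of (c, as, e) \<Rightarrow> \<bar>X - (of_int c + dot as \<xi>)\<bar> \<le> of_int e)"

lemma dot_Nil2 [simp]: "dot as [] = 0"
  by (cases as) auto

lemma dot_padded_add: "dot (padded_add as bs) \<xi> = dot as \<xi> + dot bs \<xi>"
proof (induction as bs arbitrary: \<xi> rule: padded_add.induct)
  case (1 a as b bs)
  then show ?case by (cases \<xi>) (auto simp: algebra_simps)
qed auto

lemma dot_scale: "dot (map ((*) k) as) \<xi> = of_int k * dot as \<xi>"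
proof (induction as arbitrary: \<xi>)
  case (Cons a as)
  then show ?case by (cases \<xi>) (auto simp: algebra_simps)
qed simp

lemma noise_Cons: "noise (x # \<xi>) \<longleftrightarrow> \<bar>x\<bar> \<le> 1 \<and> noise \<xi>"
  by (auto simp: noise_def)

lemma abs_sum_nonneg: "0 \<le> abs_sum as"
  by (induction as) auto

lemma int_length_nonneg: "0 \<le> int_length as"
  by (induction as) auto

lemma abs_dot_le:
  assumes "noise \<xi>"
  shows "\<bar>dot as \<xi>\<bar> \<le> of_int (abs_sum as)"
  using assms
proof (induction as arbitrary: \<xi>)
  case (Cons a as)
  show ?case
  proof (cases \<xi>)
    case Nil
    then show ?thesis using abs_sum_nonneg[of as] by simp
  next
    case (Cons x xs)
    then have x: "\<bar>x\<bar> \<le> 1" and xs: "noise xs" using Cons.prems by (auto simp: noise_Cons)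
    have "\<bar>real_of_int a * x\<bar> \<le> \<bar>real_of_int a\<bar>"
      using mult_left_mono[OF x, of "\<bar>real_of_int a\<bar>"] by (simp add: abs_mult)
    then show ?thesis using Cons.IH[OF xs] Cons by simp
  qed
qed simp

text \<open>Fixed-point scale: the integers in a form count multiples of \<open>1 / unit\<close>.\<close>

definition unit :: int
  where "unit = 100000000000000000"

fun fadd :: "form \<Rightarrow> form \<Rightarrow> form"
  where "fadd (c, as, e) (c', as', e') = (c + c', padded_add as as', e + e')"

fun fscale :: "int \<Rightarrow> form \<Rightarrow> form"
  where "fscale k (c, as, e) = (k * c, map ((*) k) as, \<bar>k\<bar> * e)"

definition fsub :: "form \<Rightarrow> form \<Rightarrow> form"
  where "fsub f g = fadd f (fscale (-1) g)"

fun lower :: "form \<Rightarrow> int"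
  where "lower (c, as, e) = c - (abs_sum as + e)"

fun mag :: "form \<Rightarrow> int"
  where "mag (c, as, e) = \<bar>c\<bar> + (abs_sum as + e)"

fun away :: "form \<Rightarrow> int"
  where "away (c, as, e) = \<bar>c\<bar> - (abs_sum as + e)"

text \<open>
  The product of two linear forms is linear up to \<open>(\<Sum> as\<^sub>i \<xi>\<^sub>i) (\<Sum> as'\<^sub>i \<xi>\<^sub>i)\<close>; this quadratic remainder and
  the cross terms of the old errors go into the new error.  Factors in units of \<open>1 / unit\<close> yield a
  product in units of \<open>1 / unit\<^sup>2\<close>, which is then rounded back.
\<close>

fun fmul0 :: "form \<Rightarrow> form \<Rightarrow> form"
  where "fmul0 (c, as, e) (c', as', e') =
    (c * c', padded_add (map ((*) c) as') (map ((*) c') as),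
     abs_sum as * abs_sum as' + e * (\<bar>c'\<bar> + (abs_sum as' + e')) + e' * (\<bar>c\<bar> + abs_sum as))"

fun fround :: "form \<Rightarrow> form"
  where "fround (c, as, e) =
    (c div unit, map (\<lambda>a. a div unit) as, e div unit + 2 + int_length as)"

definition fmul :: "form \<Rightarrow> form \<Rightarrow> form"
  where "fmul f g = fround (fmul0 f g)"

text \<open>
  The quotient is guessed to first order, with truncated coefficients; its error is then certified by
  multiplying the guess \<open>H\<close> back, \<open>X / Y - H = (X - Y H) / Y\<close>.  So the quality of the guess matters for
  precision only, never for soundness.  The auxiliary functions hand on intermediate results, so that
  rewriting evaluates each of them once.
\<close>

fun quot_slopes :: "int \<Rightarrow> form \<Rightarrow> form \<Rightarrow> int list"
  where "quot_slopes q (c, as, e) (c', as', e') =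
    map (\<lambda>x. x div c') (padded_add (map ((*) unit) as) (map ((*) (- q)) as'))"

definition fdiv_cert :: "form \<Rightarrow> form \<Rightarrow> int \<Rightarrow> int list \<Rightarrow> form"
  where "fdiv_cert f g q hs =
    (q, hs, mag (fsub (fscale unit f) (fmul0 g (q, hs, 0))) div lower g + 1)"

definition fdiv_center :: "form \<Rightarrow> form \<Rightarrow> int \<Rightarrow> form"
  where "fdiv_center f g q = fdiv_cert f g q (quot_slopes q f g)"

definition fdiv :: "form \<Rightarrow> form \<Rightarrow> form"
  where "fdiv f g = fdiv_center f g (fst f * unit div fst g)"

lemma enc_const: "\<bar>X - of_int c\<bar> \<le> of_int e \<Longrightarrow> enc \<xi> (c, [], e) X"
  by (simp add: enc_def)

lemma enc_add:
  assumes "enc \<xi> f X" "enc \<xi> g Y"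
  shows "enc \<xi> (fadd f g) (X + Y)"
  using assms by (cases f; cases g) (auto simp: enc_def dot_padded_add)

lemma enc_scale:
  assumes "enc \<xi> f X"
  shows "enc \<xi> (fscale k f) (of_int k * X)"
proof -
  obtain c as e where f: "f = (c, as, e)" by (cases f)
  have "\<bar>of_int k * X - (of_int (k * c) + of_int k * dot as \<xi>)\<bar>
      = \<bar>of_int k\<bar> * \<bar>X - (of_int c + dot as \<xi>)\<bar>"
    by (simp add: abs_mult[symmetric] algebra_simps)
  also have "\<dots> \<le> \<bar>of_int k\<bar> * of_int e"
    using assms by (intro mult_left_mono) (auto simp: f enc_def)
  finally show ?thesis by (simp add: f enc_def dot_scale)
qed

lemma enc_sub:
  assumes "enc \<xi> f X" "enc \<xi> g Y"
  shows "enc \<xi> (fsub f g) (X - Y)"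
  using enc_add[OF assms(1) enc_scale[OF assms(2), of "-1"]] by (simp add: fsub_def)

lemma enc_bounds:
  assumes "noise \<xi>" "enc \<xi> f X"
  shows "of_int (lower f) \<le> X" "\<bar>X\<bar> \<le> of_int (mag f)" "of_int (away f) \<le> \<bar>X\<bar>"
proof -
  obtain c as e where f: "f = (c, as, e)" by (cases f)
  show "of_int (lower f) \<le> X" "\<bar>X\<bar> \<le> of_int (mag f)" "of_int (away f) \<le> \<bar>X\<bar>"
    using abs_dot_le[OF assms(1), of as] assms(2) by (auto simp: f enc_def)
qed

lemma enc_mul0:
  assumes \<xi>: "noise \<xi>" and X: "enc \<xi> f X" and Y: "enc \<xi> g Y"
  shows "enc \<xi> (fmul0 f g) (X * Y)"
proof -
  obtain c as e where f: "f = (c, as, e)" by (cases f)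
  obtain c' as' e' where g: "g = (c', as', e')" by (cases g)
  define A B where "A = dot as \<xi>" and "B = dot as' \<xi>"
  define x y where "x = X - (of_int c + A)" and "y = Y - (of_int c' + B)"
  have A: "\<bar>A\<bar> \<le> of_int (abs_sum as)" and B: "\<bar>B\<bar> \<le> of_int (abs_sum as')"
    using abs_dot_le[OF \<xi>] by (simp_all add: A_def B_def)
  have x: "\<bar>x\<bar> \<le> of_int e" and y: "\<bar>y\<bar> \<le> of_int e'"
    using X Y by (simp_all add: f g enc_def x_def y_def A_def B_def)
  have XY: "X = of_int c + A + x" "Y = of_int c' + B + y" by (simp_all add: x_def y_def)
  have split: "X * Y - (of_int (c * c') + (of_int c * B + of_int c' * A))
      = A * B + x * Y + y * (of_int c + A)"
    by (simp add: XY algebra_simps)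
  have 1: "\<bar>A * B\<bar> \<le> of_int (abs_sum as) * of_int (abs_sum as')"
    unfolding abs_mult by (intro mult_mono A B) (auto simp: abs_sum_nonneg)
  have 2: "\<bar>x * Y\<bar> \<le> of_int e * of_int (\<bar>c'\<bar> + (abs_sum as' + e'))"
    unfolding abs_mult
  proof (intro mult_mono x)
    show "\<bar>Y\<bar> \<le> of_int (\<bar>c'\<bar> + (abs_sum as' + e'))"
      using B y by (simp add: XY)
  qed (use x in auto)
  have 3: "\<bar>y * (of_int c + A)\<bar> \<le> of_int e' * of_int (\<bar>c\<bar> + abs_sum as)"
    unfolding abs_mult
  proof (intro mult_mono y)
    show "\<bar>of_int c + A\<bar> \<le> of_int (\<bar>c\<bar> + abs_sum as)" using A by simp
  qed (use y in auto)
  have "\<bar>p + q + r\<bar> \<le> P + Q + R" if "\<bar>p\<bar> \<le> P" "\<bar>q\<bar> \<le> Q" "\<bar>r\<bar> \<le> R" for p q r P Q R :: real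
    using that by linarith
  from this[OF 1 2 3] have "\<bar>X * Y - (of_int (c * c') + (of_int c * B + of_int c' * A))\<bar>
     \<le> of_int (abs_sum as) * of_int (abs_sum as') + of_int e * of_int (\<bar>c'\<bar> + (abs_sum as' + e'))
        + of_int e' * of_int (\<bar>c\<bar> + abs_sum as)"
    unfolding split .
  then show ?thesis
    by (simp add: f g enc_def dot_padded_add dot_scale A_def B_def)
qed

lemma unit_pos: "0 < unit"
  by (simp add: unit_def)

lemma div_error:
  fixes a k :: int
  assumes "0 < k"
  shows "0 \<le> real_of_int a / of_int k - of_int (a div k)" "real_of_int a / of_int k - of_int (a div k) \<le> 1"
  using real_of_int_div3[of a k] real_of_int_div2[of a k] by auto

text \<open>
  Rounding down moves the center by at most one, every noise coefficient by at most one, and the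
  error, which has to be rounded up, by at most one.
\<close>

lemma enc_round:
  assumes \<xi>: "noise \<xi>" and X: "enc \<xi> f X"
  shows "enc \<xi> (fround f) (X / of_int unit)"
proof -
  obtain c as e where f: "f = (c, as, e)" by (cases f)
  have dots: "\<bar>dot as \<xi> / of_int unit - dot (map (\<lambda>a. a div unit) as) \<xi>\<bar> \<le> of_int (int_length as)"
    using \<xi>
  proof (induction as arbitrary: \<xi>)
    case (Cons a as)
    show ?case
    proof (cases \<xi>)
      case Nil
      then show ?thesis using int_length_nonneg[of as] by simp
    next
      case (Cons x xs)
      then have x: "\<bar>x\<bar> \<le> 1" and xs: "noise xs" using Cons.prems by (auto simp: noise_Cons)
      let ?r = "real_of_int a / of_int unit - of_int (a div unit)"
      have "\<bar>?r * x\<bar> \<le> 1 * 1"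
        unfolding abs_mult using div_error[OF unit_pos, of a] x by (intro mult_mono) auto
      moreover have "dot (a # as) \<xi> / of_int unit - dot (map (\<lambda>a. a div unit) (a # as)) \<xi>
          = ?r * x + (dot as xs / of_int unit - dot (map (\<lambda>a. a div unit) as) xs)"
        by (simp add: Cons algebra_simps add_divide_distrib)
      ultimately show ?thesis using Cons.IH[OF xs] by simp
    qed
  qed simp
  have "\<bar>X - (of_int c + dot as \<xi>)\<bar> \<le> of_int e" using X by (simp add: f enc_def)
  then have "\<bar>X - (of_int c + dot as \<xi>)\<bar> / of_int unit \<le> of_int e / of_int unit"
    using unit_pos by (intro divide_right_mono) auto
  then have "\<bar>X / of_int unit - (of_int c / of_int unit + dot as \<xi> / of_int unit)\<bar> \<le> of_int e / of_int unit"
  proof -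
    have "X / of_int unit - (of_int c / of_int unit + dot as \<xi> / of_int unit)
        = (X - (of_int c + dot as \<xi>)) / of_int unit"
      by (simp add: diff_divide_distrib add_divide_distrib)
    then show ?thesis
      using \<open>\<bar>X - (of_int c + dot as \<xi>)\<bar> / of_int unit \<le> of_int e / of_int unit\<close> unit_pos
      by simp
  qed
  then show ?thesis
    using dots div_error[OF unit_pos, of c] div_error[OF unit_pos, of e]
    by (simp add: f enc_def)
qed

definition encl :: "real list \<Rightarrow> form \<Rightarrow> real \<Rightarrow> bool"
  where "encl \<xi> f x \<longleftrightarrow> enc \<xi> f (of_int unit * x)"

lemma encl_mul:
  assumes "noise \<xi>" "encl \<xi> f x" "encl \<xi> g y"
  shows "encl \<xi> (fmul f g) (x * y)"
proof -
  have "of_int unit * x * (of_int unit * y) / of_int unit = of_int unit * (x * y)"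
    using unit_pos by simp
  then show ?thesis
    using enc_round[OF assms(1) enc_mul0[OF assms(1)]] assms(2,3)
    unfolding encl_def fmul_def by metis
qed

lemma encl_add: "encl \<xi> f x \<Longrightarrow> encl \<xi> g y \<Longrightarrow> encl \<xi> (fadd f g) (x + y)"
  using enc_add[of \<xi> f "of_int unit * x" g "of_int unit * y"]
  by (simp add: encl_def ring_distribs)

lemma encl_sub: "encl \<xi> f x \<Longrightarrow> encl \<xi> g y \<Longrightarrow> encl \<xi> (fsub f g) (x - y)"
  using enc_sub[of \<xi> f "of_int unit * x" g "of_int unit * y"]
  by (simp add: encl_def ring_distribs)

lemma encl_div:
  assumes \<xi>: "noise \<xi>" and x: "encl \<xi> f x" and y: "encl \<xi> g y" and pos: "0 < lower g"
  shows "encl \<xi> (fdiv f g) (x / y)"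
proof -
  define q where "q = fst f * unit div fst g"
  define hs where "hs = quot_slopes q f g"
  define R where "R = fsub (fscale unit f) (fmul0 g (q, hs, 0))"
  define H where "H = of_int q + dot hs \<xi>"
  define X Y where "X = of_int unit * x" and "Y = of_int unit * y"
  have H: "enc \<xi> (q, hs, 0) H" by (simp add: enc_def H_def)
  have R: "enc \<xi> R (of_int unit * X - Y * H)"
    unfolding R_def using x y
    by (intro enc_sub enc_scale enc_mul0 \<xi> H) (simp_all add: encl_def X_def Y_def)
  have Ylow: "of_int (lower g) \<le> Y"
    using enc_bounds(1)[OF \<xi>] y by (simp add: Y_def encl_def)
  have l: "0 < real_of_int (lower g)" using pos by simp
  then have Y: "0 < Y" using Ylow by linarith
  have mR: "0 \<le> real_of_int (mag R)" using enc_bounds(2)[OF \<xi> R] by linarith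
  have "\<bar>of_int unit * X / Y - H\<bar> = \<bar>of_int unit * X - Y * H\<bar> / Y"
    using Y by (simp add: field_simps)
  also have "\<dots> \<le> of_int (mag R) / of_int (lower g)"
    using enc_bounds(2)[OF \<xi> R] Ylow l by (intro frac_le) auto
  also have "\<dots> \<le> of_int (mag R div lower g + 1)"
    using div_error(2)[OF pos, of "mag R"] by simp
  finally have "\<bar>of_int unit * X / Y - H\<bar> \<le> of_int (mag R div lower g + 1)" .
  moreover have "of_int unit * X / Y = of_int unit * (x / y)"
    using unit_pos by (simp add: X_def Y_def)
  moreover have "fdiv f g = (q, hs, mag R div lower g + 1)"
    by (simp add: fdiv_def fdiv_center_def fdiv_cert_def q_def hs_def R_def)
  ultimately show ?thesis by (simp add: encl_def enc_def H_def)
qed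

section \<open>Enclosures for the weight recursion\<close>

text \<open>
  The recursion to be enclosed acts on relative weights \<open>u\<^sub>i\<close> and on a mean \<open>m\<close>:
  \<open>u\<^sub>i\<close> is multiplied by \<open>((m - d\<^sub>i) / m)\<^sup>2\<close>, and the new \<open>m\<close> is the mean of the \<open>d\<^sub>i\<close> under the old weights,
  where the reference component has \<open>d = 0\<close> and weight \<open>1\<close>.  Three components are followed explicitly;
  the others have total weight and moment at most \<open>2 / unit\<close>, which the error \<open>2\<close> in the base cases of
  \<open>total\<close> and \<open>moment_about\<close> absorbs.
\<close>

fun next_weights :: "form list \<Rightarrow> form \<Rightarrow> form list \<Rightarrow> form list"
  where
    "next_weights (d # ds) m (u # us) =
      fmul u (fmul (fdiv (fsub m d) m) (fdiv (fsub m d) m)) # next_weights ds m us"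
  | "next_weights _ _ _ = []"

fun total :: "form list \<Rightarrow> form"
  where
    "total [] = (unit, [], 2)"
  | "total (u # us) = fadd u (total us)"

fun center_moment :: "form list \<Rightarrow> form list \<Rightarrow> int"
  where
    "center_moment (d # ds) (u # us) = fst d * fst u + center_moment ds us"
  | "center_moment _ _ = 0"

fun moment_about :: "int \<Rightarrow> form list \<Rightarrow> form list \<Rightarrow> form"
  where
    "moment_about q (d # ds) (u # us) = fadd (fmul (fsub d (q, [], 0)) u) (moment_about q ds us)"
  | "moment_about q _ _ = fsub (0, [], 2) (fmul (q, [], 0) (unit, [], 2))"

text \<open>
  Numerator and denominator of the mean have strongly correlated errors, and dividing them directly
  would lose this correlation.  Taking the moment about a guess \<open>q\<close> of the mean makes the numerator
  small, so that the errors of the dominant weights enter with the small factors \<open>d\<^sub>i - q\<close>.  Any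
  \<open>q\<close> is sound; the quotient of the centers is a good one.
\<close>

definition mean_about :: "int \<Rightarrow> form list \<Rightarrow> form list \<Rightarrow> form"
  where "mean_about q ds us = fadd (q, [], 0) (fdiv (moment_about q ds us) (total us))"

definition mean :: "form list \<Rightarrow> form list \<Rightarrow> form"
  where "mean ds us = mean_about (center_moment ds us div fst (total us)) ds us"

fun step :: "form list \<Rightarrow> form list \<times> form \<Rightarrow> form list \<times> form"
  where "step ds (us, m) = (next_weights ds m us, mean ds us)"

text \<open>
  The first bound keeps the mean above all additional eigenvalues, the second one yields the lower
  bounds on the rates, and the third one justifies the division in the next mean.
\<close>

fun admissible :: "form list \<Rightarrow> form list \<times> form \<Rightarrow> bool"
  where "admissible ds (us, m) \<longleftrightarrow>
    unit div 500 \<le> lower m \<and> list_all (\<lambda>d. unit div 1000 \<le> away (fsub m d)) ds \<and> 0 < lower (total us)"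

fun run :: "form list \<Rightarrow> nat \<Rightarrow> form list \<times> form \<Rightarrow> (form list \<times> form) option"
  where
    "run ds 0 s = Some s"
  | "run ds (Suc n) s = (if admissible ds s then run ds n (step ds s) else None)"

lemma encl_const: "\<bar>of_int unit * x - of_int c\<bar> \<le> of_int e \<Longrightarrow> encl \<xi> (c, [], e) x"
  by (simp add: encl_def enc_const)

lemma encl_exact: "encl \<xi> (q, [], 0) (of_int q / of_int unit)"
  using unit_pos by (intro encl_const) simp

lemma next_weights_sound:
  assumes \<xi>: "noise \<xi>" and m: "encl \<xi> mf m" "0 < lower mf"
    and ds: "list_all2 (\<lambda>f i. encl \<xi> f (d i)) ds is"
    and us: "list_all2 (\<lambda>f i. encl \<xi> f (u i)) us is"
  shows "list_all2 (\<lambda>f i. encl \<xi> f (u i * ((m - d i) / m)\<^sup>2)) (next_weights ds mf us) is"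
  using ds us
proof (induction ds "is" arbitrary: us rule: list_all2_induct)
  case (Cons f fs i js)
  then obtain g gs where us: "us = g # gs" "encl \<xi> g (u i)" "list_all2 (\<lambda>f i. encl \<xi> f (u i)) gs js"
    by (auto simp: list_all2_Cons2)
  have "encl \<xi> (fdiv (fsub mf f) mf) ((m - d i) / m)"
    using Cons m \<xi> by (intro encl_div encl_sub) auto
  then have "encl \<xi> (fmul g (fmul (fdiv (fsub mf f) mf) (fdiv (fsub mf f) mf)))
      (u i * ((m - d i) / m)\<^sup>2)"
    unfolding power2_eq_square using us \<xi> by (intro encl_mul) auto
  then show ?case using Cons us by simp
qed auto

lemma total_sound:
  assumes "\<bar>of_int unit * \<eta>\<bar> \<le> 2" "list_all2 (\<lambda>f i. encl \<xi> f (u i)) us is"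
  shows "encl \<xi> (total us) (1 + \<eta> + (\<Sum>i\<leftarrow>is. u i))"
  using assms(2)
proof (induction us "is" rule: list_all2_induct)
  case Nil
  then show ?case using assms(1) by (auto intro!: encl_const simp: ring_distribs)
next
  case (Cons f fs i js)
  then have "encl \<xi> (fadd f (total fs)) (u i + (1 + \<eta> + (\<Sum>i\<leftarrow>js. u i)))"
    by (intro encl_add) auto
  then show ?case by (simp add: algebra_simps)
qed

lemma moment_sound:
  fixes q :: int
  defines "c \<equiv> of_int q / of_int unit"
  assumes \<xi>: "noise \<xi>" and \<zeta>: "\<bar>of_int unit * \<zeta>\<bar> \<le> 2" and \<eta>: "\<bar>of_int unit * \<eta>\<bar> \<le> 2"
    and ds: "list_all2 (\<lambda>f i. encl \<xi> f (d i)) ds is"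
    and us: "list_all2 (\<lambda>f i. encl \<xi> f (u i)) us is"
  shows "encl \<xi> (moment_about q ds us) (\<zeta> - c * (1 + \<eta>) + (\<Sum>i\<leftarrow>is. (d i - c) * u i))"
  using ds us
proof (induction ds "is" arbitrary: us rule: list_all2_induct)
  case Nil
  have "encl \<xi> (fsub (0, [], 2) (fmul (q, [], 0) (unit, [], 2))) (\<zeta> - c * (1 + \<eta>))"
    unfolding c_def using \<zeta> \<eta> \<xi>
    by (intro encl_sub encl_mul encl_exact encl_const) (auto simp: ring_distribs)
  then show ?case using Nil by simp
next
  case (Cons f fs i js)
  then obtain g gs where us: "us = g # gs" "encl \<xi> g (u i)" "list_all2 (\<lambda>f i. encl \<xi> f (u i)) gs js"
    by (auto simp: list_all2_Cons2)
  have "encl \<xi> (fadd (fmul (fsub f (q, [], 0)) g) (moment_about q fs gs))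
      ((d i - c) * u i + (\<zeta> - c * (1 + \<eta>) + (\<Sum>i\<leftarrow>js. (d i - c) * u i)))"
    using Cons us \<xi> unfolding c_def by (intro encl_add encl_mul encl_sub encl_exact) auto
  then show ?case by (simp add: us(1) algebra_simps)
qed

lemma mean_sound:
  assumes \<xi>: "noise \<xi>" and \<zeta>: "\<bar>of_int unit * \<zeta>\<bar> \<le> 2" and \<eta>: "\<bar>of_int unit * \<eta>\<bar> \<le> 2"
    and ds: "list_all2 (\<lambda>f i. encl \<xi> f (d i)) ds is"
    and us: "list_all2 (\<lambda>f i. encl \<xi> f (u i)) us is"
    and pos: "0 < lower (total us)"
  shows "encl \<xi> (mean ds us) ((\<zeta> + (\<Sum>i\<leftarrow>is. d i * u i)) / (1 + \<eta> + (\<Sum>i\<leftarrow>is. u i)))"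
proof -
  define q where "q = center_moment ds us div fst (total us)"
  define c where "c = real_of_int q / of_int unit"
  define D where "D = 1 + \<eta> + (\<Sum>i\<leftarrow>is. u i)"
  have tot: "encl \<xi> (total us) D"
    unfolding D_def using \<eta> us by (rule total_sound)
  then have "0 < of_int unit * D"
    using enc_bounds(1)[OF \<xi>, of "total us" "of_int unit * D"] pos by (simp add: encl_def)
  then have D: "D > 0" using unit_pos by (simp add: zero_less_mult_iff)
  have sum: "(\<Sum>i\<leftarrow>is. (d i - c) * u i) = (\<Sum>i\<leftarrow>is. d i * u i) - c * (\<Sum>i\<leftarrow>is. u i)"
    by (induction "is") (auto simp: algebra_simps)
  have "encl \<xi> (mean ds us) (c + (\<zeta> - c * (1 + \<eta>) + (\<Sum>i\<leftarrow>is. (d i - c) * u i)) / D)"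
    unfolding mean_def mean_about_def q_def[symmetric]
    unfolding c_def by (intro encl_add encl_exact encl_div moment_sound tot pos assms)
  also have "c + (\<zeta> - c * (1 + \<eta>) + (\<Sum>i\<leftarrow>is. (d i - c) * u i)) / D = (\<zeta> + (\<Sum>i\<leftarrow>is. d i * u i)) / D"
    using D unfolding sum by (simp add: field_simps) (simp add: D_def algebra_simps)
  finally show ?thesis by (simp add: D_def)
qed

text \<open>
  The components outside the list \<open>is\<close> enter through \<open>\<zeta>\<close> and \<open>\<eta>\<close> only.  They are known to be small
  at time \<open>k\<close> only if the mean was not small before, so the assumption \<open>tail\<close> is conditional and the
  bounds on \<open>m\<close> and on the tail have to be propagated together.  Note that \<open>m 0\<close> and \<open>m 1\<close> coincide.
\<close>

locale weight_recursion =
  fixes "is" :: "'i list" and d :: "'i \<Rightarrow> real" and u :: "nat \<Rightarrow> 'i \<Rightarrow> real"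
    and m \<zeta> \<eta> :: "nat \<Rightarrow> real" and ds :: "form list"
  assumes u_Suc: "\<And>k i. i \<in> set is \<Longrightarrow> u (Suc k) i = u k i * ((m k - d i) / m k)\<^sup>2"
    and m_0: "m 0 = (\<zeta> 0 + (\<Sum>i\<leftarrow>is. d i * u 0 i)) / (1 + \<eta> 0 + (\<Sum>i\<leftarrow>is. u 0 i))"
    and m_Suc: "\<And>k. m (Suc k) = (\<zeta> k + (\<Sum>i\<leftarrow>is. d i * u k i)) / (1 + \<eta> k + (\<Sum>i\<leftarrow>is. u k i))"
    and tail: "\<And>k. (\<And>j. j < k \<Longrightarrow> 1/500 \<le> m j) \<Longrightarrow>
      \<bar>of_int unit * \<zeta> k\<bar> \<le> 2 \<and> \<bar>of_int unit * \<eta> k\<bar> \<le> 2"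
    and ds: "list_all2 (\<lambda>f i. \<forall>\<xi>. encl \<xi> f (d i)) ds is"
begin

definition encloses :: "real list \<Rightarrow> form list \<times> form \<Rightarrow> nat \<Rightarrow> bool"
  where "encloses \<xi> s k \<longleftrightarrow>
    list_all2 (\<lambda>f i. encl \<xi> f (u k i)) (fst s) is \<and> encl \<xi> (snd s) (m k)"

definition separated :: "nat \<Rightarrow> bool"
  where "separated k \<longleftrightarrow> 1/500 \<le> m k \<and> (\<forall>i\<in>set is. 1/1000 \<le> \<bar>m k - d i\<bar>)"

lemma ds_encl: "list_all2 (\<lambda>f i. encl \<xi> f (d i)) ds is"
  using ds by (rule list_all2_mono) auto

lemma encloses_start:
  assumes "noise \<xi>" "list_all2 (\<lambda>f i. encl \<xi> f (u 0 i)) us is" "0 < lower (total us)"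
  shows "encloses \<xi> (us, mean ds us) 0"
  unfolding encloses_def m_0 using assms tail[of 0] ds_encl
  by (auto intro!: mean_sound)

lemma admissible_separated:
  assumes \<xi>: "noise \<xi>" and s: "encloses \<xi> s k" and ok: "admissible ds s"
  shows "separated k"
proof -
  obtain us mf where s': "s = (us, mf)" by (cases s)
  have mf: "encl \<xi> mf (m k)" using s by (simp add: s' encloses_def)
  have U: "of_int (unit div 500) = real_of_int unit * (1/500)"
    "of_int (unit div 1000) = real_of_int unit * (1/1000)" by (simp_all add: unit_def)
  have "real_of_int unit * (1/500) \<le> of_int unit * m k"
    using enc_bounds(1)[OF \<xi> mf[unfolded encl_def]] ok unfolding U[symmetric] s' by simp
  moreover have "1/1000 \<le> \<bar>m k - d i\<bar>" if i: "i \<in> set is" for i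
  proof -
    obtain n where n: "n < length is" "i = is ! n" using i by (auto simp: in_set_conv_nth)
    define f where "f = ds ! n"
    have f: "f \<in> set ds" "encl \<xi> f (d i)"
      using ds_encl[of \<xi>] n by (auto simp: list_all2_conv_all_nth f_def)
    have "encl \<xi> (fsub mf f) (m k - d i)" using f mf by (intro encl_sub)
    then have "real_of_int (away (fsub mf f)) \<le> \<bar>of_int unit * (m k - d i)\<bar>"
      using enc_bounds(3)[OF \<xi>] unfolding encl_def by blast
    moreover have "unit div 1000 \<le> away (fsub mf f)"
      using ok f(1) by (simp add: s' list_all_iff)
    ultimately have "real_of_int unit * (1/1000) \<le> of_int unit * \<bar>m k - d i\<bar>"
      using unit_pos unfolding U[symmetric] by (simp add: abs_mult)
    then show ?thesis using unit_pos by (simp only: mult_le_cancel_left_pos of_int_0_less_iff)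
  qed
  ultimately show ?thesis
    unfolding separated_def using unit_pos by (simp only: mult_le_cancel_left_pos of_int_0_less_iff) blast
qed

lemma encloses_step:
  assumes \<xi>: "noise \<xi>" and s: "encloses \<xi> s k" and ok: "admissible ds s"
    and before: "\<And>j. j < k \<Longrightarrow> separated j"
  shows "encloses \<xi> (step ds s) (Suc k)"
proof -
  obtain us mf where s': "s = (us, mf)" by (cases s)
  have *: "list_all2 (\<lambda>f i. encl \<xi> f (u k i)) us is" "encl \<xi> mf (m k)"
    using s by (simp_all add: s' encloses_def)
  have "0 < unit div 500" by (simp add: unit_def)
  then have pos: "0 < lower mf" "0 < lower (total us)" using ok by (auto simp: s')
  have "list_all2 (\<lambda>f i. encl \<xi> f (u (Suc k) i)) (next_weights ds mf us) is"
    using next_weights_sound[OF \<xi> *(2) pos(1) ds_encl *(1)]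
    by (rule list.rel_mono_strong) (simp add: u_Suc)
  moreover have "encl \<xi> (mean ds us) (m (Suc k))"
    unfolding m_Suc using tail[of k] before * pos ds_encl \<xi>
    by (intro mean_sound) (auto simp: separated_def)
  ultimately show ?thesis by (simp add: s' encloses_def)
qed

lemma run_sound:
  assumes "noise \<xi>" "encloses \<xi> s k" "\<And>j. j < k \<Longrightarrow> separated j" "run ds n s = Some t"
  shows "(\<forall>j<k + n. separated j) \<and> encloses \<xi> t (k + n)"
  using assms(2-4)
proof (induction n arbitrary: s k)
  case (Suc n)
  then have ok: "admissible ds s" and r: "run ds n (step ds s) = Some t"
    by (auto split: if_splits)
  have "separated j" if "j < Suc k" for j
    using that Suc.prems(2) admissible_separated[OF assms(1) Suc.prems(1) ok]
    by (cases "j = k") auto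
  then show ?case
    using Suc.IH[OF encloses_step[OF assms(1) Suc.prems(1) ok Suc.prems(2)] _ r] by simp
qed auto

end

section \<open>The attracting cycle\<close>

text \<open>
  The model spectrum \<open>0, 0.10915118, 0.9974, 1\<close>, measured from its smallest element, was tuned such that the
  recursion has an attracting cycle of period seven: the derivative of the seven-step map has
  spectral radius about \<open>0.6\<close>.  The second eigenvalue was chosen such that suitable initial weights,
  for which the mean is not a free parameter, lead onto that cycle after only five steps.
\<close>

definition gaps :: "form list"
  where "gaps = [(10915118000000000, [], 2), (99740000000000000, [], 2), (100000000000000000, [], 2)]"

definition start_weights :: "form list"
  where "start_weights = [(5332044000000000000, [], 2), (219298300000, [], 2), (262179300000, [], 2)]"

text \<open>
  The center of the trap approximates a point of the cycle, and its edges are small multiples of the real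
  eigenvectors and of the real and imaginary part of the complex eigenvector of the derivative of
  the seven-step map; in these coordinates that derivative contracts the maximum norm.  The edges are
  rounded coarsely, so that their exact inverse has short entries.
\<close>

definition trap :: "form list \<times> form"
  where "trap =
    ([(16143104508558699, [71800000000, -42000000000, 81800000000, 31700000000], 0),
      (500498422431116192, [-5000000000000, -5000000000000, -4230000000000, -2680000000000], 0),
      (868908446771223928, [-1290000000000, 4550000000000, -1800000000000, -1270000000000], 0)],
     (99882993792081731, [360000000, 478000000, 261000000, 92000000], 0))"

fun combination :: "int list \<Rightarrow> form list \<Rightarrow> form"
  where
    "combination (k # ks) (f # fs) = fadd (fscale k f) (combination ks fs)"
  | "combination _ _ = (0, [], 0)"

fun deviations :: "form list \<times> form \<Rightarrow> form list"
  where "deviations (us, m) = map2 (\<lambda>f z. fsub f (fst z, [], 0)) (us @ [m]) (fst trap @ [snd trap])"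

text \<open>
  The inverse of the matrix of edges of the trap, multiplied by \<open>34312694500000000000\<close> to make it
  integral.
\<close>

definition solve_rows :: "int list list"
  where "solve_rows =
    [[-1979314200, 25945513, -57467514, 644505350000],
     [231721200, -5912943, 12107404, -84954850000],
     [2606681600, -16388774, 61449272, -527316800000],
     [-853842600, -24310086, -12361892, -211642700000]]"

text \<open>
  The coordinates of the state with respect to the edges of the trap lie in the cube again; the
  comparison is scaled by the common denominator of the inverse.
\<close>

definition trapped :: "form list \<times> form \<Rightarrow> bool"
  where "trapped s \<longleftrightarrow>
    list_all (\<lambda>row. mag (combination row (deviations s)) \<le> 34312694500000000000) solve_rows"

fun returns :: "(form list \<times> form) option \<Rightarrow> bool"
  where
    "returns (Some s) = trapped s"
  | "returns None = False"

text \<open>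
  The two computations on which everything rests.  From the initial weights, whose enclosure needs no
  noise, five steps lead into the trap; from an arbitrary point of the trap, described by four noise
  variables, seven steps lead back.  A result other than failure also certifies that the
  mean stayed away from all eigenvalues on the way.
\<close>

lemma start_enters_trap: "returns (run gaps 5 (start_weights, mean gaps start_weights))"
  by code_simp

lemma trap_returns: "returns (run gaps 7 trap)"
  by code_simp

lemma combination_sound:
  assumes "noise \<xi>" "enc \<xi> f1 V1" "enc \<xi> f2 V2" "enc \<xi> f3 V3" "enc \<xi> f4 V4"
    and "mag (combination [a, b, c, d] [f1, f2, f3, f4]) \<le> 34312694500000000000"
  shows "\<bar>(of_int a * V1 + of_int b * V2 + of_int c * V3 + of_int d * V4) / 34312694500000000000\<bar> \<le> 1"
proof -
  have "enc \<xi> (combination [a, b, c, d] [f1, f2, f3, f4])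
     (of_int a * V1 + (of_int b * V2 + (of_int c * V3 + (of_int d * V4 + 0))))"
    unfolding combination.simps using assms by (intro enc_add enc_scale) (auto simp: enc_def)
  from enc_bounds(2)[OF assms(1) this] assms(6) show ?thesis
    by (simp add: add.assoc)
qed

text \<open>
  The noise vector of the enclosure of the current state is exchanged for the coordinates of the
  true state in the trap, which become the noise for the next seven steps.
\<close>

lemma trapped_sound:
  assumes \<xi>: "noise \<xi>" and tr: "trapped (us, mf)"
    and us: "list_all2 (\<lambda>f x. encl \<xi> f x) us [x1, x2, x3]" and m: "encl \<xi> mf x4"
  obtains \<xi>' where "noise \<xi>'" "list_all2 (\<lambda>f x. encl \<xi>' f x) (fst trap) [x1, x2, x3]" "encl \<xi>' (snd trap) x4"
proof -
  obtain f1 f2 f3 where us': "us = [f1, f2, f3]"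
    using us by (auto simp: list_all2_Cons2)
  define V1 where "V1 = of_int unit * x1 - 16143104508558699"
  define V2 where "V2 = of_int unit * x2 - 500498422431116192"
  define V3 where "V3 = of_int unit * x3 - 868908446771223928"
  define V4 where "V4 = of_int unit * x4 - 99882993792081731"
  let ?D = "34312694500000000000 :: real"
  have shift: "enc \<xi> (fsub f (c, [], 0)) (of_int unit * x - of_int c)" if "encl \<xi> f x" for f c x
    using that by (intro enc_sub) (auto simp: encl_def enc_def)
  have e: "encl \<xi> f1 x1" "encl \<xi> f2 x2" "encl \<xi> f3 x3" using us by (simp_all add: us')
  have V: "enc \<xi> (fsub f1 (16143104508558699, [], 0)) V1" "enc \<xi> (fsub f2 (500498422431116192, [], 0)) V2"
    "enc \<xi> (fsub f3 (868908446771223928, [], 0)) V3" "enc \<xi> (fsub mf (99882993792081731, [], 0)) V4"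
    using shift[OF e(1), of 16143104508558699] shift[OF e(2), of 500498422431116192]
      shift[OF e(3), of 868908446771223928] shift[OF m, of 99882993792081731]
    by (simp_all add: V1_def V2_def V3_def V4_def)
  define y1 where "y1 = (-1979314200 * V1 + 25945513 * V2 + -57467514 * V3 + 644505350000 * V4) / ?D"
  define y2 where "y2 = (231721200 * V1 + -5912943 * V2 + 12107404 * V3 + -84954850000 * V4) / ?D"
  define y3 where "y3 = (2606681600 * V1 + -16388774 * V2 + 61449272 * V3 + -527316800000 * V4) / ?D"
  define y4 where "y4 = (-853842600 * V1 + -24310086 * V2 + -12361892 * V3 + -211642700000 * V4) / ?D"
  have "\<bar>y1\<bar> \<le> 1" "\<bar>y2\<bar> \<le> 1" "\<bar>y3\<bar> \<le> 1" "\<bar>y4\<bar> \<le> 1"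
    using tr combination_sound[OF \<xi> V, of "-1979314200" 25945513 "-57467514" 644505350000]
      combination_sound[OF \<xi> V, of 231721200 "-5912943" 12107404 "-84954850000"]
      combination_sound[OF \<xi> V, of 2606681600 "-16388774" 61449272 "-527316800000"]
      combination_sound[OF \<xi> V, of "-853842600" "-24310086" "-12361892" "-211642700000"]
    unfolding y1_def y2_def y3_def y4_def trapped_def solve_rows_def us' trap_def
    by (simp_all add: trap_def del: combination.simps mag.simps)
  then have "noise [y1, y2, y3, y4]" by (simp add: noise_def)
  moreover have
    "V1 = 71800000000 * y1 + -42000000000 * y2 + 81800000000 * y3 + 31700000000 * y4"
    "V2 = -5000000000000 * y1 + -5000000000000 * y2 + -4230000000000 * y3 + -2680000000000 * y4"
    "V3 = -1290000000000 * y1 + 4550000000000 * y2 + -1800000000000 * y3 + -1270000000000 * y4"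
    "V4 = 360000000 * y1 + 478000000 * y2 + 261000000 * y3 + 92000000 * y4"
    unfolding y1_def y2_def y3_def y4_def by (simp_all add: field_simps)
  ultimately show thesis
    by (intro that[of "[y1, y2, y3, y4]"]) (simp_all add: trap_def encl_def enc_def V1_def V2_def V3_def V4_def)
qed

lemma lower_total_start: "0 < lower (total start_weights)"
  by (simp add: start_weights_def unit_def)

text \<open>
  Induction over the periods: at the times \<open>5 + 7 n\<close> the state is in the trap.
\<close>

theorem separated_forever:
  assumes "weight_recursion [i1, i2, i3] d u m \<zeta> \<eta> gaps"
    and u0: "list_all2 (\<lambda>f i. \<forall>\<xi>. encl \<xi> f (u 0 i)) start_weights [i1, i2, i3]"
  shows "weight_recursion.separated [i1, i2, i3] d m k"
proof -
  interpret weight_recursion "[i1, i2, i3]" d u m \<zeta> \<eta> gaps by fact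
  have start: "encloses [] (start_weights, mean gaps start_weights) 0"
    by (intro encloses_start lower_total_start list_all2_mono[OF u0]) (auto simp: noise_def)
  have enter: "\<exists>\<xi>. noise \<xi> \<and> encloses \<xi> trap k"
    if h: "noise \<xi>" "encloses \<xi> s k" "trapped s" for \<xi> s k
  proof -
    obtain us mf where s: "s = (us, mf)" by (cases s)
    have *: "list_all2 (\<lambda>f x. encl \<xi> f x) us [u k i1, u k i2, u k i3]" "encl \<xi> mf (m k)"
      using h(2) by (auto simp: encloses_def s list_all2_Cons2)
    obtain \<xi>' where "noise \<xi>'" "list_all2 (\<lambda>f x. encl \<xi>' f x) (fst trap) [u k i1, u k i2, u k i3]"
      "encl \<xi>' (snd trap) (m k)"
      by (rule trapped_sound[OF h(1) h(3)[unfolded s] *])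
    then show ?thesis unfolding encloses_def by (auto simp: list_all2_Cons2)
  qed
  have "(\<forall>j<5 + 7 * n. separated j) \<and> (\<exists>\<xi>. noise \<xi> \<and> encloses \<xi> trap (5 + 7 * n))" for n
  proof (induction n)
    case 0
    obtain s where s: "run gaps 5 (start_weights, mean gaps start_weights) = Some s" "trapped s"
      using start_enters_trap by (metis returns.elims(2))
    have "(\<forall>j<0 + 5. separated j) \<and> encloses [] s (0 + 5)"
      by (rule run_sound[OF _ start _ s(1)]) (auto simp: noise_def)
    then show ?case using enter[of "[]" s 5] s(2) by (simp add: noise_def)
  next
    case (Suc n)
    then obtain \<xi> where \<xi>: "noise \<xi>" "encloses \<xi> trap (5 + 7 * n)" by blast
    obtain s where s: "run gaps 7 trap = Some s" "trapped s"
      using trap_returns by (metis returns.elims(2))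
    have "(\<forall>j<5 + 7 * n + 7. separated j) \<and> encloses \<xi> s (5 + 7 * n + 7)"
      using Suc by (intro run_sound[OF \<xi> _ s(1)]) auto
    then show ?case using enter[OF \<xi>(1) _ s(2)] by (simp add: algebra_simps)
  qed
  from this[of "Suc k"] show ?thesis by auto
qed

section \<open>Additional eigenvalues\<close>

definition weighted_mean :: "('n::finite \<Rightarrow> real) \<Rightarrow> 'n \<Rightarrow> ('n \<Rightarrow> real) \<Rightarrow> real"
  where "weighted_mean d i0 u = (\<Sum>i\<in>-{i0}. d i * u i) / (1 + (\<Sum>i\<in>-{i0}. u i))"

text \<open>
  The recursion for all components, in a form that is defined whether or not denominators vanish.
  So separation can be proved for it first, and the method itself be identified with it afterwards.
\<close>

primrec weights :: "('n::finite \<Rightarrow> real) \<Rightarrow> 'n \<Rightarrow> ('n \<Rightarrow> real) \<Rightarrow> nat \<Rightarrow> ('n \<Rightarrow> real) \<times> real"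
  where
    "weights d i0 u0 0 = (u0, weighted_mean d i0 u0)"
  | "weights d i0 u0 (Suc k) =
      (let (u, m) = weights d i0 u0 k
       in (\<lambda>i. u i * ((m - d i) / m)\<^sup>2, weighted_mean d i0 u))"

text \<open>
  The tolerances are two units of the fixed-point scale; \<open>u\<close> are the weights relative to
  component \<open>i0\<close>, and \<open>d\<close> the distances of the eigenvalues from that of \<open>i0\<close>.
\<close>

definition close_to_model :: "'n::finite \<Rightarrow> 'n \<Rightarrow> 'n \<Rightarrow> 'n \<Rightarrow> ('n \<Rightarrow> real) \<Rightarrow> ('n \<Rightarrow> real) \<Rightarrow> bool"
  where "close_to_model i0 i1 i2 i3 d u \<longleftrightarrow>
    \<bar>d i1 - 0.10915118\<bar> \<le> 2 / 10^17 \<and> \<bar>d i2 - 0.9974\<bar> \<le> 2 / 10^17 \<and> \<bar>d i3 - 1\<bar> \<le> 2 / 10^17 \<and>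
    \<bar>u i1 - 53.32044\<bar> \<le> 2 / 10^17 \<and> \<bar>u i2 - 0.000002192983\<bar> \<le> 2 / 10^17 \<and>
    \<bar>u i3 - 0.000002621793\<bar> \<le> 2 / 10^17 \<and>
    (\<forall>i\<in>-{i0, i1, i2, i3}. 0 \<le> d i \<and> d i \<le> 1/1000 \<and> 0 \<le> u i) \<and>
    (\<Sum>i\<in>-{i0, i1, i2, i3}. u i) \<le> 2 / 10^17"

lemma encl_decimal:
  assumes "\<bar>x - x0\<bar> \<le> 2 / 10^17" "of_int unit * x0 = of_int c"
  shows "encl \<xi> (c, [], 2) x"
proof (rule encl_const)
  have "of_int unit * \<bar>x - x0\<bar> \<le> of_int unit * (2 / 10^17)"
    using assms(1) unit_pos by (intro mult_left_mono) auto
  moreover have "of_int unit * x - of_int c = of_int unit * (x - x0)"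
    using assms(2) by (simp add: algebra_simps)
  ultimately show "\<bar>of_int unit * x - of_int c\<bar> \<le> of_int 2"
    using unit_pos by (simp add: abs_mult) (simp add: unit_def)
qed

text \<open>
  A component with \<open>0 \<le> d i \<le> 1/1000\<close> is multiplied by \<open>((m - d i) / m)\<^sup>2 \<le> 1\<close> as long as
  \<open>m \<ge> 1/500\<close>.  So weights of eigenvalues just above the smallest one never grow relative to
  that of the smallest one, and arbitrarily many such eigenvalues can be added to the model.
\<close>

lemma weights_separated:
  fixes i0 i1 i2 i3 :: "'n::finite"
  assumes dist: "distinct [i0, i1, i2, i3]" and good: "close_to_model i0 i1 i2 i3 d u0"
  shows "1/500 \<le> snd (weights d i0 u0 k)" "i \<noteq> i0 \<Longrightarrow> 1/1000 \<le> \<bar>snd (weights d i0 u0 k) - d i\<bar>"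
proof -
  define u where "u k = fst (weights d i0 u0 k)" for k
  define m where "m k = snd (weights d i0 u0 k)" for k
  define E where "E = -{i0, i1, i2, i3}"
  define \<zeta> where "\<zeta> k = (\<Sum>i\<in>E. d i * u k i)" for k
  define \<eta> where "\<eta> k = (\<Sum>i\<in>E. u k i)" for k
  have split: "(\<Sum>i\<in>-{i0}. f i) = (\<Sum>i\<in>E. f i) + (\<Sum>i\<leftarrow>[i1, i2, i3]. f i)" for f :: "'n \<Rightarrow> real"
  proof -
    have *: "-{i0} = insert i1 (insert i2 (insert i3 E))" using dist by (auto simp: E_def)
    have "i1 \<notin> insert i2 (insert i3 E)" "i2 \<notin> insert i3 E" "i3 \<notin> E"
      using dist by (auto simp: E_def)
    then show ?thesis unfolding * by (simp del: Compl_eq insert_iff add: insert_iff)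
  qed
  have mean: "weighted_mean d i0 (u k)
      = (\<zeta> k + (\<Sum>i\<leftarrow>[i1, i2, i3]. d i * u k i)) / (1 + \<eta> k + (\<Sum>i\<leftarrow>[i1, i2, i3]. u k i))" for k
    unfolding weighted_mean_def split \<zeta>_def \<eta>_def by (simp add: add.assoc)
  have uS: "u (Suc k) i = u k i * ((m k - d i) / m k)\<^sup>2" for k i
    by (simp add: u_def m_def split_beta Let_def)
  have mS: "m (Suc k) = weighted_mean d i0 (u k)" "m 0 = weighted_mean d i0 (u 0)" for k
    by (simp_all add: u_def m_def split_beta Let_def)
  have E: "0 \<le> d i" "d i \<le> 1/1000" "0 \<le> u0 i" if "i \<in> E" for i
    using good that by (auto simp: close_to_model_def E_def)
  have shrink: "0 \<le> u k i \<and> u k i \<le> u0 i" if "i \<in> E" "\<And>j. j < k \<Longrightarrow> 1/500 \<le> m j" for i k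
    using that(2)
  proof (induction k)
    case 0
    then show ?case using E[OF that(1)] by (simp add: u_def)
  next
    case (Suc k)
    have m: "1/500 \<le> m k" using Suc.prems by simp
    have "((m k - d i) / m k)\<^sup>2 \<le> 1"
      using E[OF that(1)] m by (intro power_le_one) auto
    moreover have IH: "0 \<le> u k i" "u k i \<le> u0 i" using Suc by auto
    ultimately have "u k i * ((m k - d i) / m k)\<^sup>2 \<le> u k i" by (simp add: mult_left_le)
    then show ?case using IH unfolding uS by auto
  qed
  have small: "\<bar>of_int unit * \<zeta> k\<bar> \<le> 2 \<and> \<bar>of_int unit * \<eta> k\<bar> \<le> 2"
    if "\<And>j. j < k \<Longrightarrow> 1/500 \<le> m j" for k
  proof -
    have u: "0 \<le> u k i" "u k i \<le> u0 i" if "i \<in> E" for i using shrink[OF that] \<open>\<And>j. j < k \<Longrightarrow> 1/500 \<le> m j\<close> by auto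
    have "\<eta> k \<le> (\<Sum>i\<in>E. u0 i)" unfolding \<eta>_def by (intro sum_mono u)
    then have \<eta>: "\<eta> k \<le> 2 / 10^17" using good by (simp add: close_to_model_def E_def)
    have "d i * u k i \<le> u k i" if "i \<in> E" for i
      using mult_right_mono[of "d i" 1 "u k i"] E[OF that] u[OF that] by simp
    then have "\<zeta> k \<le> \<eta> k" unfolding \<eta>_def \<zeta>_def by (intro sum_mono)
    moreover have "0 \<le> \<zeta> k" "0 \<le> \<eta> k"
      unfolding \<eta>_def \<zeta>_def using u E by (auto intro!: sum_nonneg)
    ultimately show ?thesis using \<eta> by (simp add: unit_def)
  qed
  have rec: "weight_recursion [i1, i2, i3] d u m \<zeta> \<eta> gaps"
  proof (unfold_locales)
    have "\<bar>d i1 - 0.10915118\<bar> \<le> 2 / 10^17" "\<bar>d i2 - 0.9974\<bar> \<le> 2 / 10^17" "\<bar>d i3 - 1\<bar> \<le> 2 / 10^17"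
      using good by (simp_all only: close_to_model_def)
    note this[THEN encl_decimal]
    then show "list_all2 (\<lambda>f i. \<forall>\<xi>. encl \<xi> f (d i)) gaps [i1, i2, i3]"
      by (simp add: gaps_def unit_def)
  qed (use uS mean mS small in auto)
  have "\<bar>u 0 i1 - 53.32044\<bar> \<le> 2 / 10^17" "\<bar>u 0 i2 - 0.000002192983\<bar> \<le> 2 / 10^17"
    "\<bar>u 0 i3 - 0.000002621793\<bar> \<le> 2 / 10^17"
    using good by (simp_all only: close_to_model_def u_def weights.simps fst_conv)
  note this[THEN encl_decimal]
  then have "list_all2 (\<lambda>f i. \<forall>\<xi>. encl \<xi> f (u 0 i)) start_weights [i1, i2, i3]"
    by (simp add: start_weights_def unit_def)
  from separated_forever[OF rec this, of k]
  have sep: "1/500 \<le> m k" "\<And>i. i \<in> {i1, i2, i3} \<Longrightarrow> 1/1000 \<le> \<bar>m k - d i\<bar>"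
    unfolding weight_recursion.separated_def[OF rec] by auto
  show "1/500 \<le> snd (weights d i0 u0 k)" using sep(1) by (simp add: m_def)
  show "1/1000 \<le> \<bar>snd (weights d i0 u0 k) - d i\<bar>" if "i \<noteq> i0"
  proof (cases "i \<in> {i1, i2, i3}")
    case True
    then show ?thesis using sep(2) by (simp add: m_def)
  next
    case False
    then have "i \<in> E" using that by (auto simp: E_def)
    then show ?thesis using sep(1) E(2)[of i] unfolding m_def by linarith
  qed
qed

section \<open>Eigenvectors of nearly diagonal matrices\<close>

definition diag :: "('n::finite \<Rightarrow> real) \<Rightarrow> real^'n^'n"
  where "diag \<mu> = (\<chi> i j. if i = j then \<mu> i else 0)"

lemma diag_mult [simp]: "(diag \<mu> *v x) $ i = \<mu> i * x $ i"
proof -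
  have "(diag \<mu> *v x) $ i = (\<Sum>j\<in>UNIV. (if i = j then \<mu> i else 0) * x $ j)"
    by (simp add: matrix_vector_mult_def diag_def)
  also have "\<dots> = (\<Sum>j\<in>UNIV. if i = j then \<mu> i * x $ j else 0)"
    by (intro sum.cong) auto
  finally show ?thesis by simp
qed

lemma det_diag_shift: "det (diag \<mu> - x *\<^sub>R mat 1) = (\<Prod>i\<in>UNIV. \<mu> i - x)"
proof -
  have "det (diag \<mu> - x *\<^sub>R mat 1) = (\<Prod>i\<in>UNIV. (diag \<mu> - x *\<^sub>R mat 1) $ i $ i)"
    by (rule det_diagonal) (simp add: diag_def mat_def)
  then show ?thesis by (simp add: diag_def mat_def)
qed

lemma continuous_on_det [continuous_intros]:
  fixes f :: "'a::topological_space \<Rightarrow> real^'n::finite^'n"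
  assumes "continuous_on S f"
  shows "continuous_on S (\<lambda>x. det (f x))"
  unfolding det_def by (intro continuous_intros assms)

lemma singular_kernel:
  fixes A :: "real^'n::finite^'n"
  assumes "det A = 0"
  obtains v where "norm v = 1" "A *v v = 0"
proof -
  have "\<not> invertible A" using assms by (simp add: invertible_det_nz)
  then have "\<not> (\<exists>B. B ** A = mat 1)"
    using invertible_left_inverse by blast
  then obtain x where x: "A *v x = 0" "x \<noteq> 0" unfolding matrix_left_invertible_ker by blast
  show thesis
    using x by (intro that[of "x /\<^sub>R norm x"]) (simp_all add: matrix_vector_mult_scaleR)
qed

lemma root_between:
  fixes f :: "real \<Rightarrow> real"
  assumes "a \<le> b" "f a * f b < 0" "continuous_on {a..b} f"
  obtains x where "a < x" "x < b" "f x = 0"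
proof -
  have "\<exists>x\<ge>a. x \<le> b \<and> f x = 0"
  proof (cases "f a < 0")
    case True
    then show ?thesis using assms by (intro IVT') (auto simp: mult_less_0_iff)
  next
    case False
    then show ?thesis using assms by (intro IVT2') (auto simp: mult_less_0_iff)
  qed
  then obtain x where "a \<le> x" "x \<le> b" "f x = 0" by blast
  then show thesis using assms(2) by (intro that[of x]) (auto simp: order_less_le)
qed

lemma symmetric_inner:
  fixes A :: "real^'n::finite^'n"
  assumes "transpose A = A"
  shows "(A *v x) \<bullet> y = x \<bullet> (A *v y)"
  by (metis assms dot_lmul_matrix transpose_matrix_vector)

text \<open>
  From \<open>A v = l v\<close> one gets \<open>(l - \<mu> j) v\<^sub>j = ((A - diag \<mu>) v)\<^sub>j\<close>, so all entries of \<open>v\<close> but the one with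
  \<open>\<mu> i\<close> near \<open>l\<close> are small.
\<close>

lemma near_diagonal_eigenvector:
  fixes A :: "real^'n::finite^'n"
  assumes v: "A *v v = l *\<^sub>R v" "norm v = 1"
    and A: "norm (A - diag \<mu>) < \<delta>" and gap: "\<And>j. j \<noteq> i \<Longrightarrow> g \<le> \<bar>\<mu> j - l\<bar>" and g: "0 < g"
  obtains w where "A *v w = l *\<^sub>R w" "norm w = 1" "norm (w - axis i 1) \<le> 2 * CARD('n) * (\<delta> / g)"
proof -
  define w where "w = (if v $ i \<ge> 0 then v else - v)"
  have w: "A *v w = l *\<^sub>R w" "norm w = 1" "w $ i \<ge> 0"
    using v using matrix_vector_mult_scaleR[of A "-1" v] by (auto simp: w_def)
  have d: "0 \<le> \<delta>" using A norm_ge_zero[of "A - diag \<mu>"] by linarith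
  have small: "\<bar>w $ j\<bar> \<le> \<delta> / g" if "j \<noteq> i" for j
  proof -
    have "(l - \<mu> j) * w $ j = ((A - diag \<mu>) *v w) $ j"
      by (simp add: matrix_vector_mult_diff_rdistrib w algebra_simps)
    also have "\<bar>\<dots>\<bar> \<le> norm ((A - diag \<mu>) $ j) * norm w"
      unfolding matrix_vector_mul_component by (rule Cauchy_Schwarz_ineq2)
    also have "\<dots> \<le> \<delta>" using Finite_Cartesian_Product.norm_nth_le[of "A - diag \<mu>" j] A w by simp
    finally have "\<bar>\<mu> j - l\<bar> * \<bar>w $ j\<bar> \<le> \<delta>" by (simp add: abs_mult abs_minus_commute)
    moreover have "g * \<bar>w $ j\<bar> \<le> \<bar>\<mu> j - l\<bar> * \<bar>w $ j\<bar>"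
      using gap[OF that] by (intro mult_right_mono) auto
    ultimately show ?thesis using g by (simp add: field_simps)
  qed
  have off: "(\<Sum>j\<in>UNIV-{i}. \<bar>w $ j\<bar>) \<le> CARD('n) * (\<delta> / g)"
  proof -
    have "(\<Sum>j\<in>UNIV-{i}. \<bar>w $ j\<bar>) \<le> card (UNIV-{i}) * (\<delta> / g)"
      using small by (intro sum_bounded_above) auto
    also have "\<dots> \<le> CARD('n) * (\<delta> / g)"
      using d g by (intro mult_right_mono) (auto intro!: card_mono)
    finally show ?thesis .
  qed
  have "1 \<le> (\<Sum>j\<in>UNIV. \<bar>w $ j\<bar>)" using norm_le_l1_cart[of w] w by simp
  also have "\<dots> = \<bar>w $ i\<bar> + (\<Sum>j\<in>UNIV-{i}. \<bar>w $ j\<bar>)" by (simp add: sum.remove)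
  finally have "1 - w $ i \<le> CARD('n) * (\<delta> / g)" using off w by simp
  moreover have "w $ i \<le> 1" using component_le_norm_cart[of w i] w by simp
  ultimately have i: "\<bar>(w - axis i 1) $ i\<bar> \<le> CARD('n) * (\<delta> / g)" by (simp add: axis_def)
  have "norm (w - axis i 1) \<le> (\<Sum>j\<in>UNIV. \<bar>(w - axis i 1) $ j\<bar>)" by (rule norm_le_l1_cart)
  also have "\<dots> = \<bar>(w - axis i 1) $ i\<bar> + (\<Sum>j\<in>UNIV-{i}. \<bar>(w - axis i 1) $ j\<bar>)"
    by (subst sum.remove[of UNIV i]) auto
  also have "(\<Sum>j\<in>UNIV-{i}. \<bar>(w - axis i 1) $ j\<bar>) = (\<Sum>j\<in>UNIV-{i}. \<bar>w $ j\<bar>)"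
    by (intro sum.cong) (auto simp: axis_def)
  finally have "norm (w - axis i 1) \<le> CARD('n) * (\<delta> / g) + CARD('n) * (\<delta> / g)"
    using i off by linarith
  then show thesis using w by (intro that[of w]) (auto simp: mult_ac)
qed

text \<open>
  The characteristic polynomial of the diagonal matrix changes sign at each \<open>\<mu> i\<close>.  By continuity of the
  determinant it still changes sign between \<open>\<mu> i - e\<close> and \<open>\<mu> i + e\<close> for a nearby matrix, which gives \<open>n\<close>
  distinct eigenvalues; by symmetry their eigenvectors are orthogonal.  This avoids the spectral
  theorem.
\<close>

lemma near_diagonal_eigenbasis:
  fixes \<mu> :: "'n::finite \<Rightarrow> real"
  assumes \<mu>: "inj \<mu>" and e: "0 < \<epsilon>"
  obtains \<delta> where "0 < \<delta>"
    "\<And>A. transpose A = A \<Longrightarrow> norm (A - diag \<mu>) < \<delta> \<Longrightarrow>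
      \<exists>l v. inj l \<and> (\<forall>i. \<bar>l i - \<mu> i\<bar> < \<epsilon> \<and> A *v v i = l i *\<^sub>R v i \<and> norm (v i - axis i 1) < \<epsilon>) \<and>
        (\<forall>i j. v i \<bullet> v j = (if i = j then 1 else 0))"
proof -
  define g where "g = Min (insert 1 ((\<lambda>(i, j). \<bar>\<mu> i - \<mu> j\<bar>) ` {(i, j). i \<noteq> j}))"
  have g: "0 < g" unfolding g_def using \<mu> by (subst Min_gr_iff) (auto simp: inj_eq)
  have gap: "g \<le> \<bar>\<mu> i - \<mu> j\<bar>" if "i \<noteq> j" for i j
    unfolding g_def using that by (intro Min_le) auto
  define e where "e = min \<epsilon> (g / 3)"
  have e: "0 < e" "e \<le> \<epsilon>" "3 * e \<le> g" using assms(2) g by (auto simp: e_def)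
  define F where "F A x = det (A - x *\<^sub>R mat 1)" for A :: "real^'n^'n" and x
  have sign: "F (diag \<mu>) (\<mu> i - e) * F (diag \<mu>) (\<mu> i + e) < 0" for i
  proof -
    have "F (diag \<mu>) (\<mu> i - e) * F (diag \<mu>) (\<mu> i + e) = (\<Prod>j\<in>UNIV. (\<mu> j - (\<mu> i - e)) * (\<mu> j - (\<mu> i + e)))"
      by (simp add: F_def det_diag_shift prod.distrib)
    also have "\<dots> = (\<Prod>j\<in>UNIV. (\<mu> j - \<mu> i)\<^sup>2 - e\<^sup>2)"
      by (intro prod.cong) (auto simp: power2_eq_square algebra_simps)
    also have "\<dots> = - e\<^sup>2 * (\<Prod>j\<in>UNIV-{i}. (\<mu> j - \<mu> i)\<^sup>2 - e\<^sup>2)"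
      by (subst prod.remove[of UNIV i]) auto
    also have "\<dots> < 0"
    proof -
      have "0 < (\<mu> j - \<mu> i)\<^sup>2 - e\<^sup>2" if "j \<noteq> i" for j
      proof -
        have "\<bar>e\<bar> < \<bar>\<mu> j - \<mu> i\<bar>" using gap[OF that] e by linarith
        then show ?thesis by (simp add: abs_less_iff power2_strict_mono)
      qed
      then have "0 < (\<Prod>j\<in>UNIV-{i}. (\<mu> j - \<mu> i)\<^sup>2 - e\<^sup>2)" by (intro prod_pos) auto
      then show ?thesis using e by simp
    qed
    finally show ?thesis .
  qed
  have "\<forall>\<^sub>F A in nhds (diag \<mu>). F A (\<mu> i - e) * F A (\<mu> i + e) < 0" for i
  proof -
    define G where "G A = F A (\<mu> i - e) * F A (\<mu> i + e)" for A
    have "continuous_on UNIV G"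
      unfolding G_def F_def by (intro continuous_intros)
    then have "(G \<longlongrightarrow> G (diag \<mu>)) (nhds (diag \<mu>))"
      by (simp add: continuous_on_eq_continuous_at isCont_def tendsto_at_iff_tendsto_nhds)
    then have "\<forall>\<^sub>F A in nhds (diag \<mu>). G A < 0"
      using sign[of i] unfolding G_def by (rule order_tendstoD)
    then show ?thesis by (simp add: G_def)
  qed
  then have "\<forall>\<^sub>F A in nhds (diag \<mu>). \<forall>i. F A (\<mu> i - e) * F A (\<mu> i + e) < 0"
    by (simp add: eventually_all_finite)
  then obtain \<delta>0 where \<delta>0: "0 < \<delta>0"
    "\<And>A i. norm (A - diag \<mu>) < \<delta>0 \<Longrightarrow> F A (\<mu> i - e) * F A (\<mu> i + e) < 0"
    unfolding eventually_nhds_metric by (auto simp: dist_norm)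
  define \<delta> where "\<delta> = min \<delta>0 (e * g / (8 * CARD('n)))"
  have n: "0 < real CARD('n)" by simp
  show thesis
  proof (rule that)
    show "0 < \<delta>" using \<delta>0 e g n by (simp add: \<delta>_def)
    fix A :: "real^'n^'n"
    assume sym: "transpose A = A" and A: "norm (A - diag \<mu>) < \<delta>"
    have ex: "\<exists>l w. \<bar>l - \<mu> i\<bar> < e \<and> A *v w = l *\<^sub>R w \<and> norm w = 1 \<and> norm (w - axis i 1) < \<epsilon>" for i
    proof -
      have "F A (\<mu> i - e) * F A (\<mu> i + e) < 0" using \<delta>0(2) A by (simp add: \<delta>_def)
      moreover have "continuous_on {\<mu> i - e..\<mu> i + e} (F A)"
        unfolding F_def by (intro continuous_intros)
      ultimately obtain l where l: "\<mu> i - e < l" "l < \<mu> i + e" "F A l = 0"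
        using e(1) by (elim root_between[rotated]) auto
      then obtain v where v: "norm v = 1" "(A - l *\<^sub>R mat 1) *v v = 0"
        unfolding F_def using singular_kernel by blast
      have "A *v v = l *\<^sub>R v"
        using v(2) by (simp add: matrix_vector_mult_diff_rdistrib scaleR_matrix_vector_assoc[symmetric])
      moreover have "g / 2 \<le> \<bar>\<mu> j - l\<bar>" if "j \<noteq> i" for j
        using gap[OF that] l e by linarith
      moreover have "0 < g / 2" using g by simp
      ultimately obtain w where w: "A *v w = l *\<^sub>R w" "norm w = 1"
        "norm (w - axis i 1) \<le> 2 * CARD('n) * (\<delta> / (g / 2))"
        using near_diagonal_eigenvector[of A v l \<mu> \<delta> i "g / 2"] v(1) A by blast
      have "\<delta> \<le> e * g / (8 * CARD('n))" by (simp add: \<delta>_def)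
      then have "2 * CARD('n) * (\<delta> / (g / 2)) \<le> e / 2" using g n by (simp add: field_simps)
      then have "norm (w - axis i 1) < \<epsilon>" using w(3) e by linarith
      then show ?thesis using w l by (intro exI[of _ l] exI[of _ w]) auto
    qed
    then obtain l v where lv: "\<And>i. \<bar>l i - \<mu> i\<bar> < e \<and> A *v v i = l i *\<^sub>R v i \<and> norm (v i) = 1 \<and> norm (v i - axis i 1) < \<epsilon>"
      by metis
    have ne: "l i \<noteq> l j" if "i \<noteq> j" for i j
      using gap[OF that] lv[of i] lv[of j] e by linarith
    have "v i \<bullet> v j = (if i = j then 1 else 0)" for i j
    proof (cases "i = j")
      case True
      then show ?thesis using lv[of i] by (simp add: dot_square_norm)
    next
      case False
      have "l i * (v i \<bullet> v j) = l j * (v i \<bullet> v j)"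
        using symmetric_inner[OF sym, of "v i" "v j"] lv[of i] lv[of j] by simp
      then show ?thesis using ne[OF False] False by simp
    qed
    moreover have "inj l" using ne by (auto simp: inj_def)
    ultimately show "\<exists>l v. inj l \<and> (\<forall>i. \<bar>l i - \<mu> i\<bar> < \<epsilon> \<and> A *v v i = l i *\<^sub>R v i \<and> norm (v i - axis i 1) < \<epsilon>) \<and>
        (\<forall>i j. v i \<bullet> v j = (if i = j then 1 else 0))"
      using lv e(2) by (intro exI[of _ l] exI[of _ v]) (auto intro: less_le_trans)
  qed
qed

section \<open>Orthonormal eigenbases\<close>

locale eigenbasis =
  fixes A :: "real^'n::finite^'n" and l :: "'n \<Rightarrow> real" and v :: "'n \<Rightarrow> real^'n"
  assumes eigen: "A *v v i = l i *\<^sub>R v i"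
    and orthonormal: "v i \<bullet> v j = (if i = j then 1 else 0)"
    and inj_l: "inj l"
begin

lemma inj_v: "inj v"
  by (rule injI) (metis orthonormal zero_neq_one)

lemma span_v: "span (range v) = UNIV"
proof -
  have "pairwise orthogonal (range v)"
    by (auto simp: pairwise_def orthogonal_def orthonormal)
  moreover have "0 \<notin> range v" using orthonormal by (metis inner_zero_left rangeE zero_neq_one)
  ultimately have "independent (range v)" by (rule pairwise_orthogonal_independent)
  moreover have "card (range v) = CARD('n)" using inj_v by (simp add: card_image)
  moreover have "dim (UNIV :: (real^'n) set) = CARD('n)" by simp
  ultimately have "UNIV \<subseteq> span (range v)" by (intro card_ge_dim_independent) auto
  then show ?thesis by blast
qed

lemma expand: "x = (\<Sum>i\<in>UNIV. (x \<bullet> v i) *\<^sub>R v i)"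
proof -
  define y where "y = x - (\<Sum>i\<in>UNIV. (x \<bullet> v i) *\<^sub>R v i)"
  have y: "y \<bullet> v j = 0" for j
    by (simp add: y_def inner_diff_left inner_sum_left orthonormal if_distrib[of "(*) _"] cong: if_cong)
  then have "orthogonal y z" if "z \<in> span (range v)" for z
    using y by (intro orthogonal_to_span[OF that]) (auto simp: orthogonal_def)
  then have "y = 0" using orthogonal_self span_v by blast
  then show ?thesis by (simp add: y_def)
qed

lemma inner_coeffs: "x \<bullet> y = (\<Sum>i\<in>UNIV. (x \<bullet> v i) * (y \<bullet> v i))"
proof -
  have "x \<bullet> y = (\<Sum>i\<in>UNIV. (x \<bullet> v i) *\<^sub>R v i) \<bullet> y"
    by (rule arg_cong[OF expand])
  also have "\<dots> = (\<Sum>i\<in>UNIV. (x \<bullet> v i) * (v i \<bullet> y))" by (simp add: inner_sum_left)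
  finally show ?thesis by (simp only: inner_commute[of y])
qed

lemma eq_coeffs:
  assumes "\<And>i. x \<bullet> v i = y \<bullet> v i"
  shows "x = y"
proof -
  have "(\<Sum>i\<in>UNIV. (x \<bullet> v i) *\<^sub>R v i) = (\<Sum>i\<in>UNIV. (y \<bullet> v i) *\<^sub>R v i)"
    by (simp only: assms)
  then show ?thesis by (rule trans[OF expand trans[OF _ expand[symmetric]]])
qed

lemma coeff_mult: "(A *v x) \<bullet> v i = l i * (x \<bullet> v i)"
proof -
  have "A *v x = (\<Sum>j\<in>UNIV. (x \<bullet> v j) *\<^sub>R (l j *\<^sub>R v j))"
  proof -
    have "A *v x = A *v (\<Sum>j\<in>UNIV. (x \<bullet> v j) *\<^sub>R v j)"
      by (rule arg_cong[OF expand])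
    also have "\<dots> = (\<Sum>j\<in>UNIV. A *v ((x \<bullet> v j) *\<^sub>R v j))"
      by (rule linear_sum[OF matrix_vector_mul_linear])
    finally show ?thesis by (simp only: matrix_vector_mult_scaleR eigen)
  qed
  then show ?thesis
    by (simp add: inner_sum_left orthonormal if_distrib[of "(*) _"] cong: if_cong)
qed

lemma quadratic_form: "x \<bullet> (A *v x) = (\<Sum>i\<in>UNIV. l i * (x \<bullet> v i)\<^sup>2)"
  unfolding inner_coeffs[of x "A *v x"] coeff_mult by (simp add: power2_eq_square algebra_simps)

lemma norm_coeffs: "(norm x)\<^sup>2 = (\<Sum>i\<in>UNIV. (x \<bullet> v i)\<^sup>2)"
  unfolding power2_norm_eq_inner inner_coeffs[of x x] by (simp only: power2_eq_square)

lemma nonzero_coeff: "x \<noteq> 0 \<Longrightarrow> \<exists>i. x \<bullet> v i \<noteq> 0"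
  using eq_coeffs[of x 0] by auto

lemma eigenspace_eq: "eigenspace A (l i) = span {v i}"
proof
  show "eigenspace A (l i) \<subseteq> span {v i}"
  proof
    fix w assume "w \<in> eigenspace A (l i)"
    then have w: "A *v w = l i *\<^sub>R w" by (simp add: eigenspace_def)
    have "w \<bullet> v j = 0" if "j \<noteq> i" for j
      using coeff_mult[of w j] inj_l that by (auto simp: w inj_eq)
    then have "w = (w \<bullet> v i) *\<^sub>R v i"
      by (intro eq_coeffs) (auto simp: orthonormal)
    then show "w \<in> span {v i}" by (metis span_base span_scale singletonI)
  qed
  have "v i \<in> eigenspace A (l i)" by (simp add: eigenspace_def eigen)
  then show "span {v i} \<subseteq> eigenspace A (l i)"
    by (intro span_minimal subspace_eigenspace) auto
qed

lemma spectrum_eq: "spectrum A = range l"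
proof
  show "spectrum A \<subseteq> range l"
  proof
    fix c assume "c \<in> spectrum A"
    then obtain w where w: "w \<noteq> 0" "A *v w = c *\<^sub>R w" by (auto simp: spectrum_def)
    then obtain i where "w \<bullet> v i \<noteq> 0" using nonzero_coeff by blast
    then show "c \<in> range l" using coeff_mult[of w i] w by auto
  qed
  show "range l \<subseteq> spectrum A"
  proof
    fix c assume "c \<in> range l"
    then obtain i where "c = l i" by blast
    moreover have "v i \<noteq> 0" using orthonormal[of i i] by auto
    ultimately show "c \<in> spectrum A" using eigen by (auto simp: spectrum_def)
  qed
qed

lemma simple: "simple_spectrum A"
  unfolding simple_spectrum_def spectrum_eq using inj_l by (simp add: card_image)

lemma spectral_proj_coeff:
  assumes "k \<in> {1..CARD('n)}"
  obtains i where "\<And>x. spectral_proj k A x = (x \<bullet> v i) *\<^sub>R v i"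
proof -
  have "length (sorted_list_of_set (spectrum A)) = CARD('n)"
    using simple by (simp add: simple_spectrum_def)
  then have "eigval k A \<in> set (sorted_list_of_set (spectrum A))"
    unfolding eigval_def using assms by (intro nth_mem) auto
  then obtain i where i: "eigval k A = l i"
    by (auto simp: spectrum_eq)
  have "orth_proj (span {v i}) x = (x \<bullet> v i) *\<^sub>R v i" for x
  proof (rule orth_proj_eqI)
    show "(x \<bullet> v i) *\<^sub>R v i \<in> span {v i}" by (simp add: span_base span_scale)
    fix w assume "w \<in> span {v i}"
    then show "orthogonal (x - (x \<bullet> v i) *\<^sub>R v i) w"
      by (rule orthogonal_to_span) (auto simp: orthogonal_def inner_diff_left orthonormal)
  qed auto
  then show thesis
    by (intro that[of i]) (simp add: spectral_proj_def i eigenspace_eq)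
qed

end

lemma matrix_inv_inverse:
  fixes A :: "real^'n::finite^'n"
  assumes "invertible A"
  shows "A ** matrix_inv A = mat 1" "matrix_inv A ** A = mat 1"
  using someI_ex[OF assms[unfolded invertible_def]] by (simp_all add: matrix_inv_def)

locale positive_eigenbasis = eigenbasis A l v for A :: "real^'n::finite^'n" and l v +
  assumes pos: "0 < l i" and sym: "transpose A = A"
begin

lemma pos_def_A: "pos_def A"
  unfolding pos_def_def
proof (intro conjI allI impI sym)
  fix x :: "real^'n" assume "x \<noteq> 0"
  then obtain i where "x \<bullet> v i \<noteq> 0" using nonzero_coeff by blast
  then show "0 < x \<bullet> (A *v x)"
    unfolding quadratic_form using pos
    by (intro sum_pos2[of _ i]) (auto simp: less_imp_le)
qed

lemma minimizer: "A *v minimizer A b = b"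
proof -
  have "x = 0" if "A *v x = 0" for x
    using pos_def_A that by (force simp: pos_def_def)
  then have "invertible A"
    using invertible_left_inverse matrix_left_invertible_ker by blast
  then have "A ** matrix_inv A = mat 1" by (simp add: matrix_inv_inverse)
  then show ?thesis by (simp add: minimizer_def matrix_vector_mul_assoc)
qed

lemma grad_eq: "grad A b x = A *v (x - minimizer A b)"
  by (simp add: grad_def matrix_vector_mult_diff_distrib minimizer)

lemma error_eq: "x - minimizer A b = matrix_inv A *v grad A b x"
proof -
  have "invertible A"
    using pos_def_A invertible_left_inverse matrix_left_invertible_ker
    by (metis inner_zero_right less_irrefl pos_def_def)
  then have "matrix_inv A ** A = mat 1" by (simp add: matrix_inv_inverse)
  then show ?thesis by (simp add: grad_eq matrix_vector_mul_assoc)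
qed

lemma energy_coeffs: "energy_norm A (x - minimizer A b) = sqrt (\<Sum>i\<in>UNIV. (1 / l i) * (grad A b x \<bullet> v i)\<^sup>2)"
proof -
  have "l i * ((x - minimizer A b) \<bullet> v i)\<^sup>2 = (1 / l i) * (grad A b x \<bullet> v i)\<^sup>2" for i
    using pos[of i] by (simp add: grad_eq coeff_mult power2_eq_square field_simps)
  then show ?thesis unfolding energy_norm_def quadratic_form by simp
qed

lemma quad_fun_gap:
  "quad_fun A b x - quad_fun A b (minimizer A b) = 1/2 * (energy_norm A (x - minimizer A b))\<^sup>2"
proof -
  define z where "z = minimizer A b"
  have z: "A *v z = b" by (simp add: z_def minimizer)
  have zx: "z \<bullet> (A *v x) = b \<bullet> x" using symmetric_inner[OF sym, of z x] z by simp
  have "0 \<le> (x - z) \<bullet> (A *v (x - z))"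
    using pos_def_A by (cases "x - z = 0") (auto simp: pos_def_def less_imp_le)
  then have "(energy_norm A (x - z))\<^sup>2 = (x - z) \<bullet> (A *v (x - z))"
    by (simp add: energy_norm_def)
  also have "\<dots> = x \<bullet> (A *v x) - 2 * (b \<bullet> x) + b \<bullet> z"
    by (simp add: matrix_vector_mult_diff_distrib inner_diff_left inner_diff_right z zx inner_commute)
  finally show ?thesis
    unfolding z_def[symmetric] quad_fun_def z by (simp add: inner_commute)
qed

end

section \<open>Orbits of the Barzilai--Borwein method\<close>

lemma weighted_mean_le:
  assumes "\<And>i. i \<noteq> i0 \<Longrightarrow> d i \<le> D" "\<And>i. 0 \<le> u i" "0 \<le> D"
  shows "weighted_mean d i0 u \<le> D"
proof -
  have s: "0 \<le> (\<Sum>i\<in>-{i0}. u i)" using assms by (intro sum_nonneg) auto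
  have "(\<Sum>i\<in>-{i0}. d i * u i) \<le> (\<Sum>i\<in>-{i0}. D * u i)"
    using assms by (intro sum_mono mult_right_mono) auto
  also have "\<dots> \<le> D * (1 + (\<Sum>i\<in>-{i0}. u i))"
    using assms(3) by (simp add: sum_distrib_left algebra_simps)
  finally show "weighted_mean d i0 u \<le> D"
    unfolding weighted_mean_def using s by (simp add: field_simps)
qed

text \<open>
  Coefficients are taken with respect to the eigenvectors; the squared ratios to the coefficient of
  the smallest eigenvalue \<open>l i0\<close> are the initial weights of the recursion.
\<close>

locale bb1_orbit = positive_eigenbasis A l v for A :: "real^'n::finite^'n" and l v +
  fixes b x0 :: "real^'n" and i0 i1 i2 i3 :: 'n
  assumes dist: "distinct [i0, i1, i2, i3]"
    and coeff0: "grad A b x0 \<bullet> v i \<noteq> 0"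
    and l0: "\<bar>l i0 - 17/10\<bar> \<le> 1/1000"
    and good: "close_to_model i0 i1 i2 i3 (\<lambda>i. l i - l i0)
      (\<lambda>i. ((grad A b x0 \<bullet> v i) / (grad A b x0 \<bullet> v i0))\<^sup>2)"
begin

definition "d i = l i - l i0"
definition "x k = bb1 A b x0 k"
definition "g k = grad A b (x k)"
definition "c k i = g k \<bullet> v i"
definition "w k = weights d i0 (\<lambda>i. (c 0 i / c 0 i0)\<^sup>2) k"
definition "m k = snd (w k)"

lemma good': "close_to_model i0 i1 i2 i3 d (\<lambda>i. (c 0 i / c 0 i0)\<^sup>2)"
  using good by (simp add: d_def[abs_def] c_def g_def x_def)

lemma separation: "1/500 \<le> m k" "i \<noteq> i0 \<Longrightarrow> 1/1000 \<le> \<bar>m k - d i\<bar>"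
  using weights_separated[OF dist good'] by (auto simp: m_def w_def)

lemma d_bounds: "0 \<le> d i" "d i \<le> 1001/1000"
proof -
  have "0 \<le> d i \<and> d i \<le> 1001/1000"
  proof (cases "i \<in> {i0, i1, i2, i3}")
    case True
    have "\<bar>d i1 - 0.10915118\<bar> \<le> 2 / 10^17" "\<bar>d i2 - 0.9974\<bar> \<le> 2 / 10^17" "\<bar>d i3 - 1\<bar> \<le> 2 / 10^17"
      using good' by (simp_all only: close_to_model_def)
    note this[THEN abs_le_D1] this[THEN abs_le_D2]
    then have "0 \<le> d i1 \<and> d i1 \<le> 1001/1000" "0 \<le> d i2 \<and> d i2 \<le> 1001/1000"
      "0 \<le> d i3 \<and> d i3 \<le> 1001/1000"
      by simp_all
    then show ?thesis using True by (auto simp: d_def[of i0])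
  next
    case False
    then have "0 \<le> d i \<and> d i \<le> 1/1000" using good' by (simp only: close_to_model_def) blast
    then show ?thesis by simp
  qed
  then show "0 \<le> d i" "d i \<le> 1001/1000" by auto
qed

lemma w_nonneg: "0 \<le> fst (w k) i"
  by (induction k) (auto simp: w_def split_beta Let_def)

lemma m_le: "m k \<le> 1001/1000"
proof -
  have "\<exists>u. m k = weighted_mean d i0 u \<and> (\<forall>i. 0 \<le> u i)"
  proof (cases k)
    case 0
    then show ?thesis by (auto simp: m_def w_def)
  next
    case (Suc j)
    then show ?thesis using w_nonneg[of j] by (auto simp: m_def w_def split_beta Let_def)
  qed
  then show ?thesis using weighted_mean_le[of i0 d "1001/1000"] d_bounds by force
qed

lemma rayleigh:
  assumes "c k i0 \<noteq> 0"
  shows "(g k \<bullet> (A *v g k)) / (g k \<bullet> g k) = l i0 + weighted_mean d i0 (\<lambda>i. (c k i / c k i0)\<^sup>2)"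
    "0 < g k \<bullet> g k" "0 < g k \<bullet> (A *v g k)"
proof -
  define C where "C = (c k i0)\<^sup>2"
  define u where "u i = (c k i / c k i0)\<^sup>2" for i
  have C: "C > 0" using assms by (simp add: C_def)
  have cu: "(c k i)\<^sup>2 = C * u i" for i using assms by (simp add: C_def u_def power_divide)
  have u0: "u i0 = 1" using assms by (simp add: u_def)
  define S where "S = 1 + (\<Sum>i\<in>-{i0}. u i)"
  have S: "S > 0" unfolding S_def by (intro add_pos_nonneg sum_nonneg) (auto simp: u_def)
  have gg: "g k \<bullet> g k = C * S"
  proof -
    have "g k \<bullet> g k = (\<Sum>i\<in>UNIV. (c k i)\<^sup>2)"
      unfolding inner_coeffs[of "g k" "g k"] by (simp only: c_def power2_eq_square)
    also have "\<dots> = C * (\<Sum>i\<in>UNIV. u i)" by (simp add: cu sum_distrib_left)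
    also have "(\<Sum>i\<in>UNIV. u i) = S"
      by (subst sum.remove[of UNIV i0]) (auto simp: S_def u0 Compl_eq_Diff_UNIV)
    finally show ?thesis .
  qed
  have gA: "g k \<bullet> (A *v g k) = C * (l i0 * S + (\<Sum>i\<in>-{i0}. d i * u i))"
  proof -
    have "g k \<bullet> (A *v g k) = (\<Sum>i\<in>UNIV. l i * (c k i)\<^sup>2)"
      unfolding quadratic_form by (simp add: c_def)
    also have "\<dots> = C * (\<Sum>i\<in>UNIV. l i * u i)" by (simp add: cu sum_distrib_left algebra_simps)
    also have "(\<Sum>i\<in>UNIV. l i * u i) = l i0 + (\<Sum>i\<in>-{i0}. l i * u i)"
      by (subst sum.remove[of UNIV i0]) (auto simp: u0 Compl_eq_Diff_UNIV)
    also have "(\<Sum>i\<in>-{i0}. l i * u i) = l i0 * (\<Sum>i\<in>-{i0}. u i) + (\<Sum>i\<in>-{i0}. d i * u i)"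
      by (simp add: d_def sum_distrib_left sum.distrib[symmetric] algebra_simps)
    finally show ?thesis by (simp add: S_def algebra_simps)
  qed
  show "0 < g k \<bullet> g k" using gg C S by simp
  have "0 \<le> (\<Sum>i\<in>-{i0}. d i * u i)" using d_bounds(1) by (auto intro!: sum_nonneg simp: u_def)
  then have "0 < l i0 * S + (\<Sum>i\<in>-{i0}. d i * u i)" using pos[of i0] S by (simp add: add_pos_nonneg)
  then show "0 < g k \<bullet> (A *v g k)" unfolding gA using C by simp
  have "(g k \<bullet> (A *v g k)) / (g k \<bullet> g k) = (l i0 * S + (\<Sum>i\<in>-{i0}. d i * u i)) / S"
    unfolding gg gA using C by simp
  also have "\<dots> = l i0 + (\<Sum>i\<in>-{i0}. d i * u i) / S" using S by (simp add: add_divide_distrib)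
  finally show "(g k \<bullet> (A *v g k)) / (g k \<bullet> g k) = l i0 + weighted_mean d i0 (\<lambda>i. (c k i / c k i0)\<^sup>2)"
    by (simp add: weighted_mean_def S_def u_def)
qed

lemma gradient_step:
  assumes "x (Suc k) = x k - a *\<^sub>R g k"
  shows "g (Suc k) = g k - a *\<^sub>R (A *v g k)"
  unfolding g_def[of "Suc k"] assms
  by (simp add: grad_def matrix_vector_mult_diff_distrib matrix_vector_mult_scaleR)
    (simp add: g_def grad_def)

lemma coeff_step_aux:
  assumes "x (Suc k) = x k - (1 / (l i0 + m k)) *\<^sub>R g k"
  shows "c (Suc k) i = ((m k - d i) / (l i0 + m k)) * c k i"
proof -
  have r: "l i0 + m k > 0" using separation(1)[of k] pos[of i0] by simp
  have "c (Suc k) i = c k i - (1 / (l i0 + m k)) * (l i * c k i)"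
    unfolding c_def[of "Suc k"] gradient_step[OF assms] by (simp add: inner_diff_left coeff_mult c_def)
  also have "\<dots> = ((l i0 + m k - l i) / (l i0 + m k)) * c k i" using r by (simp add: field_simps)
  finally show ?thesis by (simp add: d_def)
qed

text \<open>
  The step size is the reciprocal of the Rayleigh quotient of the previous gradient, and
  \<open>l i0 + m k\<close> is that quotient; for \<open>k = 0\<close> the exact line search along \<open>g 0\<close> gives the quotient of \<open>g 0\<close>
  itself.  Nonvanishing coefficients, agreement of the weights and the next step have to be proved
  simultaneously, because the quotient formula needs \<open>x (Suc k) \<noteq> x k\<close>.
\<close>

lemma orbit_follows_weights:
  "(\<forall>i. c k i \<noteq> 0) \<and> (\<forall>i. (c k i / c k i0)\<^sup>2 = fst (w k) i) \<and>
    x (Suc k) = x k - (1 / (l i0 + m k)) *\<^sub>R g k"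
proof (induction k)
  case 0
  have c: "c 0 i \<noteq> 0" for i using coeff0 by (simp add: c_def g_def x_def)
  have "x (Suc 0) = x 0 - ((g 0 \<bullet> g 0) / (g 0 \<bullet> (A *v g 0))) *\<^sub>R g 0"
    by (simp add: x_def g_def Let_def)
  also have "(g 0 \<bullet> g 0) / (g 0 \<bullet> (A *v g 0)) = 1 / (l i0 + m 0)"
    using rayleigh(1)[OF c[of i0]] by (simp add: m_def w_def) (metis inverse_divide inverse_eq_divide)
  finally show ?case using c by (simp add: w_def)
next
  case (Suc k)
  then have c: "\<And>i. c k i \<noteq> 0" and u: "\<And>i. (c k i / c k i0)\<^sup>2 = fst (w k) i"
    and x: "x (Suc k) = x k - (1 / (l i0 + m k)) *\<^sub>R g k" by auto
  define r where "r = l i0 + m k"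
  have r: "r > 0" using separation(1)[of k] pos[of i0] by (simp add: r_def)
  have step: "c (Suc k) i = ((m k - d i) / r) * c k i" for i
    using coeff_step_aux[OF x] by (simp add: r_def)
  have nz: "m k - d i \<noteq> 0" for i
    using separation(1)[of k] separation(2)[of i k] by (cases "i = i0") (auto simp: d_def[of i0])
  have c': "c (Suc k) i \<noteq> 0" for i using step nz r c by simp
  have mk: "m k \<noteq> 0" using separation(1)[of k] by auto
  have u': "(c (Suc k) i / c (Suc k) i0)\<^sup>2 = fst (w (Suc k)) i" for i
  proof -
    have "c (Suc k) i / c (Suc k) i0 = (c k i / c k i0) * ((m k - d i) / m k)"
      unfolding step using r c mk by (simp add: d_def[of i0] mult_ac)
    then have "(c (Suc k) i / c (Suc k) i0)\<^sup>2 = (c k i / c k i0)\<^sup>2 * ((m k - d i) / m k)\<^sup>2"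
      by (simp only: power_mult_distrib)
    then show ?thesis unfolding u by (simp add: w_def m_def split_beta Let_def)
  qed
  have s: "x (Suc k) - x k = (- (1 / r)) *\<^sub>R g k" using x by (simp add: r_def)
  have y: "g (Suc k) - g k = (- (1 / r)) *\<^sub>R (A *v g k)" using gradient_step[OF x] by (simp add: r_def)
  have "x (Suc (Suc k)) = x (Suc k) - (((x (Suc k) - x k) \<bullet> (x (Suc k) - x k)) /
      ((x (Suc k) - x k) \<bullet> (g (Suc k) - g k))) *\<^sub>R g (Suc k)"
    by (simp add: x_def g_def Let_def)
  also have "((x (Suc k) - x k) \<bullet> (x (Suc k) - x k)) / ((x (Suc k) - x k) \<bullet> (g (Suc k) - g k))
      = (g k \<bullet> g k) / (g k \<bullet> (A *v g k))"
    unfolding s y using r by simp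
  also have "\<dots> = 1 / (l i0 + m (Suc k))"
    using rayleigh(1)[OF c[of i0]] u
    by (simp add: m_def w_def split_beta Let_def) (metis inverse_divide inverse_eq_divide)
  finally show ?case using c' u' by simp
qed

lemma coeff_step: "c (Suc k) i = ((m k - d i) / (l i0 + m k)) * c k i"
  using coeff_step_aux orbit_follows_weights by blast

text \<open>
  All eigenvalues and Rayleigh quotients lie in an interval of length at most \<open>1.001\<close> above \<open>1.699\<close>, and
  \<open>1.001 / 1.699 < 0.61\<close>.  The lower bound comes from separation:
  \<open>0.001 / 2.702\<close> is well above \<open>10\<^sup>-\<^sup>6\<close>.
\<close>

lemma coeff_bounds: "1/10^6 * \<bar>c k i\<bar> \<le> \<bar>c (Suc k) i\<bar>" "\<bar>c (Suc k) i\<bar> \<le> 61/100 * \<bar>c k i\<bar>"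
proof -
  have r: "1699/1000 \<le> l i0 + m k" "l i0 + m k \<le> 2702/1000"
    using separation(1)[of k] m_le[of k] l0 by linarith+
  have lo: "1/1000 \<le> \<bar>m k - d i\<bar>"
    using separation(1)[of k] separation(2)[of i k] by (cases "i = i0") (auto simp: d_def[of i0])
  have hi: "\<bar>m k - d i\<bar> \<le> 1001/1000"
    using separation(1)[of k] m_le[of k] d_bounds[of i] by linarith
  have "1/10^6 \<le> \<bar>(m k - d i) / (l i0 + m k)\<bar>"
    using lo r by (simp add: abs_divide field_simps)
  then show "1/10^6 * \<bar>c k i\<bar> \<le> \<bar>c (Suc k) i\<bar>"
    unfolding coeff_step abs_mult by (intro mult_right_mono) auto
  have "\<bar>(m k - d i) / (l i0 + m k)\<bar> \<le> 61/100"
    using hi r by (simp add: abs_divide field_simps)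
  then show "\<bar>c (Suc k) i\<bar> \<le> 61/100 * \<bar>c k i\<bar>"
    unfolding coeff_step abs_mult by (intro mult_right_mono) auto
qed

lemma coeff_nonzero: "c k i \<noteq> 0"
  using orbit_follows_weights by blast

lemma well_defined: "bb1_well_defined A b x0"
  unfolding bb1_well_defined_def
proof (intro conjI allI)
  show "grad A b x0 \<bullet> (A *v grad A b x0) \<noteq> 0"
    using rayleigh(3)[OF coeff_nonzero[of 0]] by (simp add: g_def x_def)
  fix k
  have x: "x (Suc k) = x k - (1 / (l i0 + m k)) *\<^sub>R g k" using orbit_follows_weights by blast
  have r: "l i0 + m k > 0" using separation(1)[of k] pos[of i0] by simp
  have "(x (Suc k) - x k) \<bullet> (g (Suc k) - g k) = (1 / (l i0 + m k))\<^sup>2 * (g k \<bullet> (A *v g k))"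
    unfolding gradient_step[OF x] unfolding x by (simp add: power2_eq_square)
  moreover have "0 < g k \<bullet> (A *v g k)" using rayleigh(3)[OF coeff_nonzero] .
  ultimately have "(x (Suc k) - x k) \<bullet> (g (Suc k) - g k) \<noteq> 0" using r by simp
  then show "(bb1 A b x0 (Suc k) - bb1 A b x0 k) \<bullet>
     (grad A b (bb1 A b x0 (Suc k)) - grad A b (bb1 A b x0 k)) \<noteq> 0"
    unfolding x_def g_def .
qed

end

section \<open>Rates of convergence\<close>

lemma power_lower_bound:
  fixes u :: "nat \<Rightarrow> real"
  assumes "0 \<le> q" "\<And>k. q * u k \<le> u (Suc k)"
  shows "q ^ k * u 0 \<le> u k"
proof (induction k)
  case (Suc k)
  then have "q * (q ^ k * u 0) \<le> q * u k" using assms(1) by (intro mult_left_mono) auto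
  then show ?case using assms(2)[of k] by (simp add: mult.assoc)
qed simp

lemma power_upper_bound:
  fixes u :: "nat \<Rightarrow> real"
  assumes "0 \<le> p" "\<And>k. u (Suc k) \<le> p * u k"
  shows "u k \<le> p ^ k * u 0"
proof (induction k)
  case (Suc k)
  then have "p * u k \<le> p * (p ^ k * u 0)" using assms(1) by (intro mult_left_mono) auto
  then show ?case using assms(2)[of k] by (simp add: mult.assoc)
qed simp

lemma linear_lower_bound_not_superlinear:
  fixes u :: "nat \<Rightarrow> real"
  assumes q: "0 < q" and u: "\<And>k. 0 < u k" and lower: "\<And>k. q * u k \<le> u (Suc k)"
  shows "ereal q \<le> liminf (\<lambda>k. ereal (u k powr (1 / real k)))"
    "\<not> root_superlinear u" "\<not> Q_superlinear u"
proof -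
  have pow: "q ^ k * u 0 \<le> u k" for k
    using q lower by (intro power_lower_bound) auto
  have "q * u 0 powr (1 / real k) \<le> u k powr (1 / real k)" if "k > 0" for k
  proof -
    have "(q ^ k * u 0) powr (1 / real k) \<le> u k powr (1 / real k)"
      using pow[of k] q u[of 0] by (intro powr_mono2) auto
    moreover have "(q ^ k) powr (1 / real k) = q"
      using q that by (simp add: powr_realpow[symmetric] powr_powr)
    ultimately show ?thesis using q u[of 0] by (simp add: powr_mult)
  qed
  then have ev: "\<forall>\<^sub>F k in sequentially. q * u 0 powr (1 / real k) \<le> u k powr (1 / real k)"
    by (intro eventually_sequentiallyI[of 1]) auto
  have "(\<lambda>k. 1 / real k) \<longlonglongrightarrow> 0" by (rule lim_1_over_n)
  then have "(\<lambda>k. q * u 0 powr (1 / real k)) \<longlonglongrightarrow> q * u 0 powr 0"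
    using u[of 0] by (intro tendsto_intros) auto
  then have lim: "(\<lambda>k. q * u 0 powr (1 / real k)) \<longlonglongrightarrow> q" using u[of 0] by simp
  then have "ereal q = liminf (\<lambda>k. ereal (q * u 0 powr (1 / real k)))"
    by (intro lim_imp_Liminf[symmetric]) auto
  also have "\<dots> \<le> liminf (\<lambda>k. ereal (u k powr (1 / real k)))"
    using ev by (intro Liminf_mono) auto
  finally show "ereal q \<le> liminf (\<lambda>k. ereal (u k powr (1 / real k)))" .
  show "\<not> root_superlinear u"
  proof
    assume "root_superlinear u"
    then have "(\<lambda>k. u k powr (1 / real k)) \<longlonglongrightarrow> 0" by (simp add: root_superlinear_def)
    from tendsto_le[OF _ this lim ev] q show False by simp
  qed
  show "\<not> Q_superlinear u"
  proof
    assume "Q_superlinear u"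
    then have "(\<lambda>k. u (Suc k) / u k) \<longlonglongrightarrow> 0" by (simp add: Q_superlinear_def)
    moreover have "q \<le> u (Suc k) / u k" for k using lower[of k] u[of k] by (simp add: field_simps)
    ultimately have "q \<le> 0" by (intro LIMSEQ_le_const) auto
    then show False using q by simp
  qed
qed

lemma weighted_norm_mono:
  fixes c c' W :: "'n::finite \<Rightarrow> real"
  assumes "\<And>i. \<bar>c i\<bar> \<le> a * \<bar>c' i\<bar>" "\<And>i. 0 \<le> W i" "0 \<le> a"
  shows "sqrt (\<Sum>i\<in>UNIV. W i * (c i)\<^sup>2) \<le> a * sqrt (\<Sum>i\<in>UNIV. W i * (c' i)\<^sup>2)"
proof -
  have "(c i)\<^sup>2 \<le> a\<^sup>2 * (c' i)\<^sup>2" for i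
    using power_mono[OF assms(1)[of i], of 2] by (simp add: power_mult_distrib)
  then have "(\<Sum>i\<in>UNIV. W i * (c i)\<^sup>2) \<le> (\<Sum>i\<in>UNIV. W i * (a\<^sup>2 * (c' i)\<^sup>2))"
    using assms(2) by (intro sum_mono mult_left_mono) auto
  also have "\<dots> = a\<^sup>2 * (\<Sum>i\<in>UNIV. W i * (c' i)\<^sup>2)" by (simp add: sum_distrib_left algebra_simps)
  finally have "sqrt (\<Sum>i\<in>UNIV. W i * (c i)\<^sup>2) \<le> sqrt (a\<^sup>2 * (\<Sum>i\<in>UNIV. W i * (c' i)\<^sup>2))"
    by (rule real_sqrt_le_mono)
  then show ?thesis using assms(3) by (simp add: real_sqrt_mult)
qed

context bb1_orbit
begin

text \<open>
  The gradient norm and the energy norm of the error are both square roots of weighted sums of the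
  squared coefficients, so the bounds for the coefficients carry over to both.
\<close>

lemma weighted_norm_step:
  assumes "\<And>i. 0 < W i"
  defines "u \<equiv> \<lambda>k. sqrt (\<Sum>i\<in>UNIV. W i * (c k i)\<^sup>2)"
  shows "1/10^6 * u k \<le> u (Suc k)" "u (Suc k) \<le> 61/100 * u k" "0 < u k"
proof -
  have W: "0 \<le> W i" for i using assms(1)[of i] by simp
  have "\<bar>c k i\<bar> \<le> 10^6 * \<bar>c (Suc k) i\<bar>" for i using coeff_bounds(1)[of k i] by simp
  then show "1/10^6 * u k \<le> u (Suc k)"
    using weighted_norm_mono[where c = "c k" and c' = "c (Suc k)" and W = W and a = "10^6"] W
    by (simp add: u_def)
  show "u (Suc k) \<le> 61/100 * u k"
    using weighted_norm_mono[where c = "c (Suc k)" and c' = "c k" and W = W and a = "61/100"] W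
      coeff_bounds(2)[of k] by (simp add: u_def)
  have "0 < (\<Sum>i\<in>UNIV. W i * (c k i)\<^sup>2)"
    using assms(1) coeff_nonzero by (intro sum_pos) auto
  then show "0 < u k" by (simp add: u_def)
qed

lemma norm_grad: "norm (grad A b (bb1 A b x0 k)) = sqrt (\<Sum>i\<in>UNIV. 1 * (c k i)\<^sup>2)"
  using norm_coeffs[of "g k"] by (simp add: c_def g_def x_def real_sqrt_unique)

lemma energy_error:
  "energy_norm A (bb1 A b x0 k - minimizer A b) = sqrt (\<Sum>i\<in>UNIV. (1 / l i) * (c k i)\<^sup>2)"
  unfolding energy_coeffs by (simp add: c_def g_def x_def)

lemmas gradient_step_bounds = weighted_norm_step[of "\<lambda>_. 1", OF zero_less_one, folded norm_grad]

lemmas energy_step_bounds = weighted_norm_step[of "\<lambda>i. 1 / l i", folded energy_error]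

lemma converges: "bb1 A b x0 \<longlonglongrightarrow> minimizer A b"
proof -
  have "(\<lambda>k. grad A b (bb1 A b x0 k)) \<longlonglongrightarrow> 0"
  proof (rule Lim_null_comparison)
    show "\<forall>\<^sub>F k in sequentially. norm (grad A b (bb1 A b x0 k)) \<le> (61/100)^k * norm (grad A b (bb1 A b x0 0))"
      using power_upper_bound[of "61/100" "\<lambda>k. norm (grad A b (bb1 A b x0 k))"]
        gradient_step_bounds by (intro always_eventually) auto
    show "(\<lambda>k. (61/100)^k * norm (grad A b (bb1 A b x0 0))) \<longlonglongrightarrow> 0"
      by (intro tendsto_mult_left_zero LIMSEQ_power_zero) simp
  qed
  then have "(\<lambda>k. matrix_inv A *v grad A b (bb1 A b x0 k)) \<longlonglongrightarrow> matrix_inv A *v 0"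
    by (rule bounded_linear.tendsto[OF matrix_vector_mul_bounded_linear])
  then have "(\<lambda>k. bb1 A b x0 k - minimizer A b) \<longlonglongrightarrow> 0"
    by (simp add: error_eq)
  then show ?thesis by (simp add: LIM_zero_iff)
qed

lemma spectral_bounds:
  assumes "j \<in> {1..CARD('n)}"
  defines "p \<equiv> \<lambda>k. spectral_proj j A (grad A b (bb1 A b x0 k))"
  shows "(1/10^6)^k * norm (p 0) \<le> norm (p k)" "norm (p k) \<le> (61/100)^k * norm (p 0)" "p 0 \<noteq> 0"
proof -
  obtain i where "\<And>y. spectral_proj j A y = (y \<bullet> v i) *\<^sub>R v i"
    using spectral_proj_coeff[OF assms(1)] by blast
  then have p: "p k = c k i *\<^sub>R v i" for k by (simp add: p_def c_def g_def x_def)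
  have "norm (v i) = 1" using orthonormal[of i i] by (simp add: norm_eq_1)
  then have n: "norm (p k) = \<bar>c k i\<bar>" for k by (simp add: p)
  show "(1/10^6)^k * norm (p 0) \<le> norm (p k)" "norm (p k) \<le> (61/100)^k * norm (p 0)"
    unfolding n using power_lower_bound[of "1/10^6" "\<lambda>k. \<bar>c k i\<bar>" k]
      power_upper_bound[of "61/100" "\<lambda>k. \<bar>c k i\<bar>" k] coeff_bounds by auto
  show "p 0 \<noteq> 0" using coeff_nonzero[of 0 i] n[of 0] by auto
qed

lemma gradient_bounds:
  "(1/10^6)^k * norm (grad A b (bb1 A b x0 0)) \<le> norm (grad A b (bb1 A b x0 k))"
  "norm (grad A b (bb1 A b x0 k)) \<le> (61/100)^k * norm (grad A b (bb1 A b x0 0))"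
  using power_lower_bound[of "1/10^6" "\<lambda>k. norm (grad A b (bb1 A b x0 k))" k]
    power_upper_bound[of "61/100" "\<lambda>k. norm (grad A b (bb1 A b x0 k))" k] gradient_step_bounds by auto

lemma energy_bounds:
  "(1/10^6)^k * energy_norm A (bb1 A b x0 0 - minimizer A b) \<le> energy_norm A (bb1 A b x0 k - minimizer A b)"
  "energy_norm A (bb1 A b x0 k - minimizer A b) \<le> (61/100)^k * energy_norm A (bb1 A b x0 0 - minimizer A b)"
  "0 < energy_norm A (bb1 A b x0 k - minimizer A b)"
proof -
  have l: "0 < 1 / l i" for i using pos[of i] by simp
  note * = energy_step_bounds[OF l]
  show "(1/10^6)^k * energy_norm A (bb1 A b x0 0 - minimizer A b) \<le> energy_norm A (bb1 A b x0 k - minimizer A b)"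
    by (rule power_lower_bound) (use * in auto)
  show "energy_norm A (bb1 A b x0 k - minimizer A b) \<le> (61/100)^k * energy_norm A (bb1 A b x0 0 - minimizer A b)"
    by (rule power_upper_bound) (use * in auto)
  show "0 < energy_norm A (bb1 A b x0 k - minimizer A b)" by (rule *(3))
qed

lemma gap_bounds:
  defines "h \<equiv> \<lambda>k. quad_fun A b (bb1 A b x0 k) - quad_fun A b (minimizer A b)"
  shows "(1/10^6)^(2*k) * h 0 \<le> h k" "h k \<le> (61/100)^(2*k) * h 0"
proof -
  define E where "E k = energy_norm A (bb1 A b x0 k - minimizer A b)" for k
  have h: "h k = 1/2 * (E k)\<^sup>2" for k unfolding h_def E_def by (rule quad_fun_gap)
  have sq: "q ^ (2 * k) * (E 0)\<^sup>2 = (q ^ k * E 0)\<^sup>2" for q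
    by (simp add: power_mult_distrib power_even_eq)
  have E: "0 < E k" for k unfolding E_def by (rule energy_bounds(3))
  have "((1/10^6)^k * E 0)\<^sup>2 \<le> (E k)\<^sup>2" "(E k)\<^sup>2 \<le> ((61/100)^k * E 0)\<^sup>2"
    using energy_bounds(1,2)[of k] E[of 0] E[of k] by (auto simp: E_def intro!: power_mono)
  then show "(1/10^6)^(2*k) * h 0 \<le> h k" "h k \<le> (61/100)^(2*k) * h 0"
    unfolding h sq[symmetric] mult.left_commute[of _ "1/2"] by simp_all
qed

lemma x0_not_minimizer: "x0 \<noteq> minimizer A b"
  using coeff0[of i0] grad_eq[of b x0] by auto

end

section \<open>Open sets of matrices and initial points\<close>

lemma eventually_close:
  fixes h :: "'a \<Rightarrow> real"
  assumes "(h \<longlongrightarrow> y) F" "0 < e"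
  shows "\<forall>\<^sub>F x in F. \<bar>h x - y\<bar> \<le> e"
  using tendstoD[OF assms] by eventually_elim (simp add: dist_real_def)

lemma close_to_model_open:
  fixes \<mu> \<gamma> :: "real^'n::finite"
  assumes dist: "distinct [i0, i1, i2, i3]"
    and \<mu>: "\<mu> $ i0 = 17/10" "\<mu> $ i1 - \<mu> $ i0 = 0.10915118" "\<mu> $ i2 - \<mu> $ i0 = 0.9974" "\<mu> $ i3 - \<mu> $ i0 = 1"
    and \<gamma>: "\<gamma> $ i0 = 1" "(\<gamma> $ i1)\<^sup>2 = 53.32044" "(\<gamma> $ i2)\<^sup>2 = 0.000002192983" "(\<gamma> $ i3)\<^sup>2 = 0.000002621793"
    and tail: "\<And>i. i \<in> -{i0, i1, i2, i3} \<Longrightarrow> 0 < \<mu> $ i - \<mu> $ i0 \<and> \<mu> $ i - \<mu> $ i0 < 1/1000"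
      "(\<Sum>i\<in>-{i0, i1, i2, i3}. (\<gamma> $ i)\<^sup>2) < 2 / 10^17"
    and nz: "\<And>i. \<gamma> $ i \<noteq> 0"
  shows "\<exists>\<epsilon>>0. \<forall>l c. (\<forall>i. \<bar>l i - \<mu> $ i\<bar> < \<epsilon>) \<longrightarrow> (\<forall>i. \<bar>c i - \<gamma> $ i\<bar> < \<epsilon>) \<longrightarrow>
      (\<forall>i. 0 < l i) \<and> (\<forall>i. c i \<noteq> 0) \<and> \<bar>l i0 - 17/10\<bar> \<le> 1/1000 \<and>
      close_to_model i0 i1 i2 i3 (\<lambda>i. l i - l i0) (\<lambda>i. (c i / c i0)\<^sup>2)"
proof -
  let ?F = "nhds (\<mu>, \<gamma>)"
  let ?t = "2 / 10^17 :: real"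
  have L: "((\<lambda>p. fst p $ i) \<longlongrightarrow> \<mu> $ i) ?F" for i
    using tendsto_vec_nth[OF tendsto_fst[OF filterlim_ident]] by fastforce
  have C: "((\<lambda>p. snd p $ i) \<longlongrightarrow> \<gamma> $ i) ?F" for i
    using tendsto_vec_nth[OF tendsto_snd[OF filterlim_ident]] by fastforce
  have D: "((\<lambda>p. fst p $ i - fst p $ i0) \<longlongrightarrow> \<mu> $ i - \<mu> $ i0) ?F" for i
    by (intro tendsto_diff L)
  have U: "((\<lambda>p. (snd p $ i / snd p $ i0)\<^sup>2) \<longlongrightarrow> (\<gamma> $ i)\<^sup>2) ?F" for i
    using tendsto_power[OF tendsto_divide[OF C[of i] C[of i0] nz[of i0]], of 2] \<gamma>(1) by simp
  have \<mu>pos: "0 < \<mu> $ i" for i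
  proof (cases "i \<in> {i0, i1, i2, i3}")
    case True
    then show ?thesis using \<mu> by auto
  next
    case False
    then show ?thesis using tail(1)[of i] \<mu>(1) by auto
  qed
  have "\<forall>\<^sub>F p in ?F. (\<forall>i. 0 < fst p $ i) \<and> (\<forall>i. snd p $ i \<noteq> 0) \<and> \<bar>fst p $ i0 - 17/10\<bar> \<le> 1/1000 \<and>
      close_to_model i0 i1 i2 i3 (\<lambda>i. fst p $ i - fst p $ i0) (\<lambda>i. (snd p $ i / snd p $ i0)\<^sup>2)"
    unfolding close_to_model_def
  proof (intro eventually_conj)
    show "\<forall>\<^sub>F p in ?F. \<forall>i. 0 < fst p $ i"
      using order_tendstoD(1)[OF L \<mu>pos] by (simp add: eventually_all_finite)
    show "\<forall>\<^sub>F p in ?F. \<forall>i. snd p $ i \<noteq> 0"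
      using tendsto_imp_eventually_ne[OF C nz] by (simp add: eventually_all_finite)
    show "\<forall>\<^sub>F p in ?F. \<bar>fst p $ i0 - 17/10\<bar> \<le> 1/1000"
      using eventually_close[OF L[of i0], of "1/1000"] \<mu>(1) by simp
    show "\<forall>\<^sub>F p in ?F. \<bar>fst p $ i1 - fst p $ i0 - 0.10915118\<bar> \<le> ?t"
      using eventually_close[OF D[of i1], of ?t] unfolding \<mu>(2) by simp
    show "\<forall>\<^sub>F p in ?F. \<bar>fst p $ i2 - fst p $ i0 - 0.9974\<bar> \<le> ?t"
      using eventually_close[OF D[of i2], of ?t] unfolding \<mu>(3) by simp
    show "\<forall>\<^sub>F p in ?F. \<bar>fst p $ i3 - fst p $ i0 - 1\<bar> \<le> ?t"
      using eventually_close[OF D[of i3], of ?t] unfolding \<mu>(4) by simp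
    show "\<forall>\<^sub>F p in ?F. \<bar>(snd p $ i1 / snd p $ i0)\<^sup>2 - 53.32044\<bar> \<le> ?t"
      using eventually_close[OF U[of i1], of ?t] unfolding \<gamma> by simp
    show "\<forall>\<^sub>F p in ?F. \<bar>(snd p $ i2 / snd p $ i0)\<^sup>2 - 0.000002192983\<bar> \<le> ?t"
      using eventually_close[OF U[of i2], of ?t] unfolding \<gamma> by simp
    show "\<forall>\<^sub>F p in ?F. \<bar>(snd p $ i3 / snd p $ i0)\<^sup>2 - 0.000002621793\<bar> \<le> ?t"
      using eventually_close[OF U[of i3], of ?t] unfolding \<gamma> by simp
    have "\<forall>\<^sub>F p in ?F. 0 \<le> fst p $ i - fst p $ i0 \<and> fst p $ i - fst p $ i0 \<le> 1/1000 \<and>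
        0 \<le> (snd p $ i / snd p $ i0)\<^sup>2" if "i \<in> -{i0, i1, i2, i3}" for i
    proof -
      have "0 < \<mu> $ i - \<mu> $ i0" "\<mu> $ i - \<mu> $ i0 < 1/1000" using tail(1)[OF that] by auto
      from order_tendstoD(1)[OF D this(1)] order_tendstoD(2)[OF D this(2)]
      show ?thesis by eventually_elim auto
    qed
    then show "\<forall>\<^sub>F p in ?F. \<forall>i\<in>-{i0, i1, i2, i3}. 0 \<le> fst p $ i - fst p $ i0 \<and>
        fst p $ i - fst p $ i0 \<le> 1/1000 \<and> 0 \<le> (snd p $ i / snd p $ i0)\<^sup>2"
      by (intro eventually_ball_finite) auto
    have "((\<lambda>p. \<Sum>i\<in>-{i0, i1, i2, i3}. (snd p $ i / snd p $ i0)\<^sup>2) \<longlongrightarrow> (\<Sum>i\<in>-{i0, i1, i2, i3}. (\<gamma> $ i)\<^sup>2)) ?F"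
      by (intro tendsto_sum U)
    from order_tendstoD(2)[OF this tail(2)]
    show "\<forall>\<^sub>F p in ?F. (\<Sum>i\<in>-{i0, i1, i2, i3}. (snd p $ i / snd p $ i0)\<^sup>2) \<le> ?t"
      by eventually_elim simp
  qed
  then obtain e where e: "0 < e" "\<And>p. dist p (\<mu>, \<gamma>) < e \<Longrightarrow>
      (\<forall>i. 0 < fst p $ i) \<and> (\<forall>i. snd p $ i \<noteq> 0) \<and> \<bar>fst p $ i0 - 17/10\<bar> \<le> 1/1000 \<and>
      close_to_model i0 i1 i2 i3 (\<lambda>i. fst p $ i - fst p $ i0) (\<lambda>i. (snd p $ i / snd p $ i0)\<^sup>2)"
    unfolding eventually_nhds_metric by blast
  define \<epsilon> where "\<epsilon> = e / (2 * CARD('n))"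
  have n: "0 < real CARD('n)" by simp
  show ?thesis
  proof (rule exI[of _ \<epsilon>], rule conjI, use e n in \<open>simp add: \<epsilon>_def\<close>, rule allI, rule allI, rule impI, rule impI)
    fix l c :: "'n \<Rightarrow> real"
    assume l: "\<forall>i. \<bar>l i - \<mu> $ i\<bar> < \<epsilon>" and c: "\<forall>i. \<bar>c i - \<gamma> $ i\<bar> < \<epsilon>"
    have "norm ((\<chi> i. l i) - \<mu>) < CARD('n) * \<epsilon>" "norm ((\<chi> i. c i) - \<gamma>) < CARD('n) * \<epsilon>"
      using l c by (auto intro!: le_less_trans[OF norm_le_l1_cart] sum_bounded_above_strict)
    moreover have "dist (\<chi> i. l i, \<chi> i. c i) (\<mu>, \<gamma>) \<le> norm ((\<chi> i. l i) - \<mu>) + norm ((\<chi> i. c i) - \<gamma>)"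
      by (simp add: dist_prod_def dist_norm sqrt_sum_squares_le_sum)
    moreover have "CARD('n) * \<epsilon> + CARD('n) * \<epsilon> = e" using n by (simp add: \<epsilon>_def)
    ultimately have "dist (\<chi> i. l i, \<chi> i. c i) (\<mu>, \<gamma>) < e" by linarith
    from e(2)[OF this] show "(\<forall>i. 0 < l i) \<and> (\<forall>i. c i \<noteq> 0) \<and> \<bar>l i0 - 17/10\<bar> \<le> 1/1000 \<and>
      close_to_model i0 i1 i2 i3 (\<lambda>i. l i - l i0) (\<lambda>i. (c i / c i0)\<^sup>2)" by simp
  qed
qed

text \<open>
  Four eigenvalues are those of the model; all others are placed just above the smallest one and
  get so little weight that their total stays below the tolerance.
\<close>

lemma model_data:
  assumes "CARD('n::finite) \<ge> 4"
  obtains i0 i1 i2 i3 :: "'n::finite" and \<mu> \<gamma> :: "real^'n::finite" where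
    "distinct [i0, i1, i2, i3]" "inj (\<lambda>i. \<mu> $ i)"
    "\<mu> $ i0 = 17/10" "\<mu> $ i1 - \<mu> $ i0 = 0.10915118" "\<mu> $ i2 - \<mu> $ i0 = 0.9974" "\<mu> $ i3 - \<mu> $ i0 = 1"
    "\<gamma> $ i0 = 1" "(\<gamma> $ i1)\<^sup>2 = 53.32044" "(\<gamma> $ i2)\<^sup>2 = 0.000002192983" "(\<gamma> $ i3)\<^sup>2 = 0.000002621793"
    "\<And>i. i \<in> -{i0, i1, i2, i3} \<Longrightarrow> 0 < \<mu> $ i - \<mu> $ i0 \<and> \<mu> $ i - \<mu> $ i0 < 1/1000"
    "(\<Sum>i\<in>-{i0, i1, i2, i3}. (\<gamma> $ i)\<^sup>2) < 2 / 10^17"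
    "\<And>i. \<gamma> $ i \<noteq> 0"
proof -
  obtain xs where xs: "set xs = (UNIV :: 'n set)" "distinct xs"
    using finite_distinct_list[of "UNIV :: 'n set"] by auto
  then have "length xs \<ge> 4" using assms by (metis distinct_card)
  then obtain i0 i1 i2 i3 ys where "xs = i0 # i1 # i2 # i3 # ys"
    by (auto simp: numeral_eq_Suc Suc_le_length_iff)
  then have d: "distinct [i0, i1, i2, i3]" using xs(2) by auto
  obtain f :: "'n \<Rightarrow> nat" where f: "inj f"
    using finite_imp_inj_to_nat_seg[of "UNIV :: 'n set"] by auto
  define h where "h i = (if i = i0 then 0 else if i = i1 then 0.10915118 else if i = i2 then 0.9974
    else if i = i3 then 1 else 1 / (2000 * (real (f i) + 1)))" for i
  have small: "0 < 1 / (2000 * (real k + 1))" "1 / (2000 * (real k + 1)) < 1/1000" for k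
    by (auto simp: field_simps add_pos_nonneg)
  define t where "t i = 1 / (2000 * (real (f i) + 1))" for i
  have t: "0 < t i" "t i < 1/1000" for i using small[of "f i"] by (simp_all only: t_def)
  then have t': "t i \<noteq> 0" "1/1000 \<le> y \<Longrightarrow> t i \<noteq> y" for i y
    by (metis less_irrefl, metis not_less)
  have t_inj: "t i = t j \<longleftrightarrow> i = j" for i j
    using f by (auto simp: t_def inj_eq)
  have h: "h i = (if i = i0 then 0 else if i = i1 then 0.10915118 else if i = i2 then 0.9974
    else if i = i3 then 1 else t i)" for i by (simp only: h_def t_def)
  have inj_h: "inj h"
  proof (rule injI)
    fix i j assume "h i = h j"
    then show "i = j"
      using t'(1)[of i] t'(1)[of j] t'(2)[of "0.10915118"] t'(2)[of "0.9974"] t'(2)[of 1]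
      by (auto simp: h t_inj split: if_splits)
  qed
  define \<kappa> where "\<kappa> = 1 / (10^17 * real CARD('n))"
  have n: "0 < real CARD('n)" by simp
  have \<kappa>: "0 < \<kappa>" using n by (simp add: \<kappa>_def)
  define q where "q i = (if i = i0 then 1 else if i = i1 then 53.32044 else if i = i2 then 0.000002192983
    else if i = i3 then 0.000002621793 else \<kappa>)" for i
  have q: "0 < q i" for i using \<kappa> by (simp add: q_def)
  define \<mu> where "\<mu> = (\<chi> i. 17/10 + h i)"
  define \<gamma> where "\<gamma> = (\<chi> i. sqrt (q i))"
  have \<gamma>2: "(\<gamma> $ i)\<^sup>2 = q i" for i using q[of i] by (simp add: \<gamma>_def)
  have "(\<Sum>i\<in>-{i0, i1, i2, i3}. (\<gamma> $ i)\<^sup>2) = (\<Sum>i\<in>-{i0, i1, i2, i3}. \<kappa>)"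
    unfolding \<gamma>2 by (intro sum.cong) (auto simp: q_def)
  also have "\<dots> \<le> (\<Sum>i\<in>(UNIV :: 'n set). \<kappa>)"
    using \<kappa> by (intro sum_mono2) auto
  also have "\<dots> = 1 / 10^17" using n by (simp add: \<kappa>_def)
  finally have sum: "(\<Sum>i\<in>-{i0, i1, i2, i3}. (\<gamma> $ i)\<^sup>2) < 2 / 10^17" by simp
  show thesis
  proof (rule that[OF d, of \<mu> \<gamma>])
    show "inj (\<lambda>i. \<mu> $ i)" using inj_h by (simp add: \<mu>_def inj_def)
    show "\<gamma> $ i0 = 1" by (simp add: \<gamma>_def q_def)
    show "\<gamma> $ i \<noteq> 0" for i using q[of i] by (simp add: \<gamma>_def)
    show "0 < \<mu> $ i - \<mu> $ i0 \<and> \<mu> $ i - \<mu> $ i0 < 1/1000" if "i \<in> -{i0, i1, i2, i3}" for i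
      using that small[of "f i"] by (simp add: \<mu>_def h_def)
  qed (use d sum in \<open>auto simp: \<mu>_def h_def \<gamma>2 q_def\<close>)
qed

text \<open>
  Both the eigenvalues and the coefficients of the initial gradient depend continuously on the
  matrix and the initial point, and the hypotheses on them are strict enough to hold in a neighbourhood
  of the diagonal model.  So a product of two balls serves for matrices and initial points, uniformly.
\<close>

lemma bb1_orbits_nearby:
  fixes b :: "real^'n::finite"
  assumes "CARD('n) \<ge> 4"
  shows "\<exists>(A0 :: 'n sym_matrix) (x00 :: real^'n). \<exists>\<delta>>0. \<forall>A x0. dist A A0 < \<delta> \<longrightarrow> dist x0 x00 < \<delta> \<longrightarrow>
      (\<exists>l v i0 i1 i2 i3. bb1_orbit (mat_of A) l v b x0 i0 i1 i2 i3)"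
proof (rule model_data[OF assms])
  fix i0 i1 i2 i3 :: 'n and \<mu> \<gamma> :: "real^'n"
  assume d: "distinct [i0, i1, i2, i3]" and inj: "inj (\<lambda>i. \<mu> $ i)" and
    \<mu>: "\<mu> $ i0 = 17/10" "\<mu> $ i1 - \<mu> $ i0 = 0.10915118" "\<mu> $ i2 - \<mu> $ i0 = 0.9974" "\<mu> $ i3 - \<mu> $ i0 = 1"
    and \<gamma>: "\<gamma> $ i0 = 1" "(\<gamma> $ i1)\<^sup>2 = 53.32044" "(\<gamma> $ i2)\<^sup>2 = 0.000002192983" "(\<gamma> $ i3)\<^sup>2 = 0.000002621793"
    and tail: "\<And>i. i \<in> -{i0, i1, i2, i3} \<Longrightarrow> 0 < \<mu> $ i - \<mu> $ i0 \<and> \<mu> $ i - \<mu> $ i0 < 1/1000"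
    "(\<Sum>i\<in>-{i0, i1, i2, i3}. (\<gamma> $ i)\<^sup>2) < 2 / 10^17"
    and nz: "\<And>i. \<gamma> $ i \<noteq> 0"
  obtain \<epsilon> where \<epsilon>: "0 < \<epsilon>"
    "\<forall>l c. (\<forall>i. \<bar>l i - \<mu> $ i\<bar> < \<epsilon>) \<longrightarrow> (\<forall>i. \<bar>c i - \<gamma> $ i\<bar> < \<epsilon>) \<longrightarrow>
      (\<forall>i. 0 < l i) \<and> (\<forall>i. c i \<noteq> 0) \<and> \<bar>l i0 - 17/10\<bar> \<le> 1/1000 \<and>
      close_to_model i0 i1 i2 i3 (\<lambda>i. l i - l i0) (\<lambda>i. (c i / c i0)\<^sup>2)"
    using close_to_model_open[OF d \<mu> \<gamma> tail nz] by blast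
  have \<mu>nz: "\<mu> $ i \<noteq> 0" for i
  proof (cases "i \<in> {i0, i1, i2, i3}")
    case True
    then show ?thesis using \<mu> by auto
  next
    case False
    then show ?thesis using tail(1)[of i] \<mu>(1) by auto
  qed
  define D where "D = diag (\<lambda>i. \<mu> $ i)"
  define N where "N = norm \<gamma> + 1"
  define \<epsilon>1 where "\<epsilon>1 = min \<epsilon> (\<epsilon> / (2 * N))"
  have \<epsilon>1: "0 < \<epsilon>1" "\<epsilon>1 \<le> \<epsilon>" "norm \<gamma> * \<epsilon>1 \<le> \<epsilon> / 2"
  proof -
    have N: "0 < N" "norm \<gamma> \<le> N" by (simp_all add: N_def add_nonneg_pos)
    then show "0 < \<epsilon>1" "\<epsilon>1 \<le> \<epsilon>" using \<epsilon>(1) by (simp_all add: \<epsilon>1_def)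
    have "norm \<gamma> * \<epsilon>1 \<le> N * (\<epsilon> / (2 * N))"
      using \<epsilon>(1) N by (intro mult_mono) (auto simp: \<epsilon>1_def)
    also have "\<dots> = \<epsilon> / 2" using N by simp
    finally show "norm \<gamma> * \<epsilon>1 \<le> \<epsilon> / 2" .
  qed
  obtain \<delta>1 where \<delta>1: "0 < \<delta>1"
    "\<And>A. transpose A = A \<Longrightarrow> norm (A - D) < \<delta>1 \<Longrightarrow>
      \<exists>l v. inj l \<and> (\<forall>i. \<bar>l i - \<mu> $ i\<bar> < \<epsilon>1 \<and> A *v v i = l i *\<^sub>R v i \<and> norm (v i - axis i 1) < \<epsilon>1) \<and>
        (\<forall>i j. v i \<bullet> v j = (if i = j then 1 else 0))"
    using near_diagonal_eigenbasis[OF inj \<epsilon>1(1), folded D_def] by blast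
  define x00 where "x00 = (\<chi> i. (\<gamma> $ i + b $ i) / \<mu> $ i)"
  have g00: "D *v x00 - b = \<gamma>"
    using \<mu>nz by (simp add: vec_eq_iff D_def x00_def)
  have "continuous_on UNIV (\<lambda>p :: (real^'n^'n) \<times> (real^'n). fst p *v snd p - b)"
    unfolding matrix_vector_mult_def by (intro continuous_intros)
  then have "\<forall>\<^sub>F p in nhds (D, x00). dist (fst p *v snd p - b) (fst (D, x00) *v snd (D, x00) - b) < \<epsilon> / 2"
    using \<epsilon>(1) by (intro tendstoD)
      (auto simp: continuous_on_eq_continuous_at isCont_def tendsto_at_iff_tendsto_nhds[of "\<lambda>p. fst p *v snd p - b"])
  then obtain \<delta>2 where \<delta>2: "0 < \<delta>2" "\<And>A x. dist (A, x) (D, x00) < \<delta>2 \<Longrightarrow> norm (A *v x - b - \<gamma>) < \<epsilon> / 2"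
    unfolding eventually_nhds_metric by (force simp: g00 dist_norm)
  define A0 where "A0 = Sym_matrix D"
  have A0: "mat_of A0 = D"
    unfolding A0_def by (rule Sym_matrix_inverse) (auto simp: D_def diag_def transpose_def vec_eq_iff)
  define \<delta> where "\<delta> = min \<delta>1 (\<delta>2 / 2)"
  show ?thesis
  proof (rule exI[of _ A0], rule exI[of _ x00], rule exI[of _ \<delta>], rule conjI,
      use \<delta>1 \<delta>2 in \<open>simp add: \<delta>_def\<close>, rule allI, rule allI, rule impI, rule impI)
    fix A :: "'n sym_matrix" and x0 :: "real^'n"
    assume A: "dist A A0 < \<delta>" and x0: "dist x0 x00 < \<delta>"
    define M where "M = mat_of A"
    have M: "norm (M - D) < \<delta>"
      using A by (simp add: dist_norm norm_sym_matrix.rep_eq minus_sym_matrix.rep_eq A0 M_def)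
    have sym: "transpose M = M" by (simp add: M_def)
    obtain l v where lv: "inj l" "\<And>i. \<bar>l i - \<mu> $ i\<bar> < \<epsilon>1" "\<And>i. M *v v i = l i *\<^sub>R v i"
      "\<And>i. norm (v i - axis i 1) < \<epsilon>1" "\<And>i j. v i \<bullet> v j = (if i = j then 1 else 0)"
      using \<delta>1(2)[OF sym] M by (auto simp: \<delta>_def)
    have "dist (M, x0) (D, x00) \<le> norm (M - D) + dist x0 x00"
      by (simp add: dist_prod_def dist_norm[of M] sqrt_sum_squares_le_sum)
    then have g: "norm (grad M b x0 - \<gamma>) < \<epsilon> / 2"
      unfolding grad_def using M x0 by (intro \<delta>2(2)) (simp add: \<delta>_def)
    have c: "\<bar>grad M b x0 \<bullet> v i - \<gamma> $ i\<bar> < \<epsilon>" for i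
    proof -
      have "norm (v i) = 1" using lv(5)[of i i] by (simp add: norm_eq_1)
      then have "\<bar>(grad M b x0 - \<gamma>) \<bullet> v i\<bar> \<le> norm (grad M b x0 - \<gamma>)"
        using Cauchy_Schwarz_ineq2[of "grad M b x0 - \<gamma>" "v i"] by simp
      moreover have "\<bar>\<gamma> \<bullet> (v i - axis i 1)\<bar> \<le> norm \<gamma> * \<epsilon>1"
        using Cauchy_Schwarz_ineq2[of \<gamma> "v i - axis i 1"]
          mult_left_mono[OF less_imp_le[OF lv(4)[of i]], of "norm \<gamma>"] by simp
      moreover have "grad M b x0 \<bullet> v i - \<gamma> $ i = (grad M b x0 - \<gamma>) \<bullet> v i + \<gamma> \<bullet> (v i - axis i 1)"
        by (simp add: inner_diff_left inner_diff_right inner_axis)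
      ultimately show ?thesis using g \<epsilon>1(3) by linarith
    qed
    have l: "\<bar>l i - \<mu> $ i\<bar> < \<epsilon>" for i using lv(2)[of i] \<epsilon>1(2) by linarith
    note * = \<epsilon>(2)[rule_format, of l "\<lambda>i. grad M b x0 \<bullet> v i", OF l c]
    have "bb1_orbit M l v b x0 i0 i1 i2 i3"
      by unfold_locales (use lv sym d * in \<open>auto simp: inj_eq\<close>)
    then show "\<exists>l v i0 i1 i2 i3. bb1_orbit (mat_of A) l v b x0 i0 i1 i2 i3"
      unfolding M_def by blast
  qed
qed

lemma open_positive_measure:
  fixes S :: "'a::euclidean_space set"
  assumes "open S" "S \<noteq> {}"
  shows "0 < emeasure lebesgue S"
proof -
  have "S \<in> sets lebesgue" using assms(1) by simp
  moreover have "S \<notin> null_sets lebesgue"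
    using open_not_negligible[OF assms] by (simp add: negligible_iff_null_sets)
  ultimately show ?thesis by (auto simp: null_sets_def zero_less_iff_neq_zero)
qed

theorem theorem2p1:
  fixes b :: "real^'n"
  assumes "CARD('n) \<ge> 4"
  shows "\<exists>(\<A> :: 'n sym_matrix set) (\<X> :: 'n sym_matrix \<Rightarrow> (real^'n) set).
    open \<A> \<and> \<A> \<noteq> {} \<and>
    (\<forall>A\<in>\<A>. pos_def (mat_of A) \<and> simple_spectrum (mat_of A)) \<and>
    (\<forall>A\<in>\<A>. open (\<X> A) \<and> \<X> A \<noteq> {} \<and> \<X> A \<subseteq> UNIV - {minimizer (mat_of A) b}) \<and>
    (\<forall>A\<in>\<A>. \<forall>x0\<in>\<X> A.
      let M = mat_of A; x = bb1 M b x0; g = (\<lambda>k. grad M b (x k)) in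
        bb1_well_defined M b x0 \<and>
        x \<longlonglongrightarrow> minimizer M b \<and>
        (\<forall>i\<in>{1..CARD('n)}. \<forall>k.
          (1 / 10^6)^k * norm (spectral_proj i M (g 0)) \<le> norm (spectral_proj i M (g k)) \<and>
          norm (spectral_proj i M (g k)) \<le> (61/100)^k * norm (spectral_proj i M (g 0))) \<and>
        (\<forall>i\<in>{1..CARD('n)}. spectral_proj i M (g 0) \<noteq> 0)) \<and>
    (let \<Omega> = {(A, x). A \<in> \<A> \<and> x \<in> \<X> A} in
        \<Omega> \<noteq> {} \<and> open \<Omega> \<and> emeasure lebesgue \<Omega> > 0 \<and>
        (\<forall>A\<in>\<A>. emeasure lebesgue (\<X> A) > 0)) \<and>
    (\<forall>A\<in>\<A>. \<forall>x0\<in>\<X> A.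
      let M = mat_of A; x = bb1 M b x0; g = (\<lambda>k. grad M b (x k));
          e = (\<lambda>k. x k - minimizer M b); f = quad_fun M b; fmin = f (minimizer M b) in
        (\<forall>k.
          (1 / 10^6)^k * norm (g 0) \<le> norm (g k) \<and>
          norm (g k) \<le> (61/100)^k * norm (g 0) \<and>
          (1 / 10^6)^k * energy_norm M (e 0) \<le> energy_norm M (e k) \<and>
          energy_norm M (e k) \<le> (61/100)^k * energy_norm M (e 0) \<and>
          (1 / 10^6)^(2*k) * (f x0 - fmin) \<le> f (x k) - fmin \<and>
          f (x k) - fmin \<le> (61/100)^(2*k) * (f x0 - fmin)) \<and>
        liminf (\<lambda>k. ereal (norm (g k) powr (1 / real k))) \<ge> ereal (1 / 10^6) \<and>
        liminf (\<lambda>k. ereal (energy_norm M (e k) powr (1 / real k))) \<ge> ereal (1 / 10^6) \<and>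
        \<not> root_superlinear (\<lambda>k. norm (g k)) \<and>
        \<not> Q_superlinear (\<lambda>k. norm (g k)) \<and>
        \<not> root_superlinear (\<lambda>k. energy_norm M (e k)) \<and>
        \<not> Q_superlinear (\<lambda>k. energy_norm M (e k)))"
proof -
  obtain A0 :: "'n sym_matrix" and x00 :: "real^'n" and \<delta> where \<delta>: "0 < \<delta>"
    and orbit: "\<And>A x0. dist A A0 < \<delta> \<Longrightarrow> dist x0 x00 < \<delta> \<Longrightarrow>
      \<exists>l v i0 i1 i2 i3. bb1_orbit (mat_of A) l v b x0 i0 i1 i2 i3"
    using bb1_orbits_nearby[OF assms, of b] by blast
  define \<A> where "\<A> = ball A0 \<delta>"
  define X where "X = ball x00 \<delta>"
  have \<A>: "open \<A>" "A0 \<in> \<A>" and X: "open X" "x00 \<in> X" using \<delta> by (simp_all add: \<A>_def X_def)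
  have ex: "\<exists>l v i0 i1 i2 i3. bb1_orbit (mat_of A) l v b x0 i0 i1 i2 i3" if "A \<in> \<A>" "x0 \<in> X" for A x0
    using that orbit[of A x0] by (simp add: \<A>_def X_def dist_commute)
  have spec: "pos_def (mat_of A) \<and> simple_spectrum (mat_of A)" if A: "A \<in> \<A>" for A
  proof -
    obtain l v i0 i1 i2 i3 where "bb1_orbit (mat_of A) l v b x00 i0 i1 i2 i3"
      using ex[OF A X(2)] by blast
    then interpret bb1_orbit "mat_of A" l v b x00 i0 i1 i2 i3 .
    show ?thesis using pos_def_A simple by simp
  qed
  have \<Omega>: "{(A, x). A \<in> \<A> \<and> x \<in> X} = \<A> \<times> X" by auto
  have \<Omega>_open: "open (\<A> \<times> X)" "\<A> \<times> X \<noteq> {}" using \<A> X by (auto intro: open_Times)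
  show ?thesis
  proof (rule exI[of _ \<A>], rule exI[of _ "\<lambda>_. X"], intro conjI ballI)
    show "open \<A>" "\<A> \<noteq> {}" "open X" "X \<noteq> {}" using \<A> X by auto
    show "pos_def (mat_of A)" "simple_spectrum (mat_of A)" if "A \<in> \<A>" for A
      using spec[OF that] by auto
    show "X \<subseteq> UNIV - {minimizer (mat_of A) b}" if A: "A \<in> \<A>" for A
    proof
      fix x0 assume x0: "x0 \<in> X"
      obtain l v i0 i1 i2 i3 where "bb1_orbit (mat_of A) l v b x0 i0 i1 i2 i3"
        using ex[OF A x0] by blast
      then interpret bb1_orbit "mat_of A" l v b x0 i0 i1 i2 i3 .
      show "x0 \<in> UNIV - {minimizer (mat_of A) b}" using x0_not_minimizer by simp
    qed
    show "let \<Omega> = {(A, x). A \<in> \<A> \<and> x \<in> X} in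
        \<Omega> \<noteq> {} \<and> open \<Omega> \<and> emeasure lebesgue \<Omega> > 0 \<and> (\<forall>A\<in>\<A>. emeasure lebesgue X > 0)"
      unfolding Let_def \<Omega>
      using \<Omega>_open open_positive_measure[OF \<Omega>_open] open_positive_measure[OF X(1)] X(2) by blast
    fix A x0 assume A: "A \<in> \<A>" and x0: "x0 \<in> X"
    obtain l v i0 i1 i2 i3 where "bb1_orbit (mat_of A) l v b x0 i0 i1 i2 i3"
      using ex[OF A x0] by blast
    then interpret bb1_orbit "mat_of A" l v b x0 i0 i1 i2 i3 .
    show "let M = mat_of A; x = bb1 M b x0; g = (\<lambda>k. grad M b (x k)) in
        bb1_well_defined M b x0 \<and>
        x \<longlonglongrightarrow> minimizer M b \<and>
        (\<forall>i\<in>{1..CARD('n)}. \<forall>k.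
          (1 / 10^6)^k * norm (spectral_proj i M (g 0)) \<le> norm (spectral_proj i M (g k)) \<and>
          norm (spectral_proj i M (g k)) \<le> (61/100)^k * norm (spectral_proj i M (g 0))) \<and>
        (\<forall>i\<in>{1..CARD('n)}. spectral_proj i M (g 0) \<noteq> 0)"
      unfolding Let_def using well_defined converges spectral_bounds by blast
    have q: "(0::real) < 1/10^6" by simp
    have l: "0 < 1 / l i" for i using pos[of i] by simp
    note G = linear_lower_bound_not_superlinear
      [of "1/10^6" "\<lambda>k. norm (grad (mat_of A) b (bb1 (mat_of A) b x0 k))", OF q gradient_step_bounds(3,1)]
    note E = linear_lower_bound_not_superlinear
      [of "1/10^6" "\<lambda>k. energy_norm (mat_of A) (bb1 (mat_of A) b x0 k - minimizer (mat_of A) b)",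
        OF q energy_bounds(3) energy_step_bounds(1)[OF l]]
    show "let M = mat_of A; x = bb1 M b x0; g = (\<lambda>k. grad M b (x k));
          e = (\<lambda>k. x k - minimizer M b); f = quad_fun M b; fmin = f (minimizer M b) in
        (\<forall>k.
          (1 / 10^6)^k * norm (g 0) \<le> norm (g k) \<and>
          norm (g k) \<le> (61/100)^k * norm (g 0) \<and>
          (1 / 10^6)^k * energy_norm M (e 0) \<le> energy_norm M (e k) \<and>
          energy_norm M (e k) \<le> (61/100)^k * energy_norm M (e 0) \<and>
          (1 / 10^6)^(2*k) * (f x0 - fmin) \<le> f (x k) - fmin \<and>
          f (x k) - fmin \<le> (61/100)^(2*k) * (f x0 - fmin)) \<and>
        liminf (\<lambda>k. ereal (norm (g k) powr (1 / real k))) \<ge> ereal (1 / 10^6) \<and>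
        liminf (\<lambda>k. ereal (energy_norm M (e k) powr (1 / real k))) \<ge> ereal (1 / 10^6) \<and>
        \<not> root_superlinear (\<lambda>k. norm (g k)) \<and>
        \<not> Q_superlinear (\<lambda>k. norm (g k)) \<and>
        \<not> root_superlinear (\<lambda>k. energy_norm M (e k)) \<and>
        \<not> Q_superlinear (\<lambda>k. energy_norm M (e k))"
      unfolding Let_def
      by (intro conjI allI gradient_bounds energy_bounds G E gap_bounds[unfolded bb1.simps(1)])
  qed
qed

end
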